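(* There exist universal constants $d>0$ and $\kappa>0$ such that, for every (sufficiently large) $n$, if $\Lambda$ is a random lattice of rank $n$ then \[\Pr\big[\mu(\Lambda)<d\sqrt n\big]\ge 1-2^{-\kappa n}.\]
   Context: A random lattice of rank $n$ is a unit-covolume lattice in $\mathbf{R}^n$ drawn according to the probability measure $\nu_n$ on $\mathrm{SL}_n(\mathbf{R})/\mathrm{SL}_n(\mathbf{Z})$ induced by the Haar measure of $\mathrm{SL}_n(\mathbf{R})$ (Siegel's measure). The covering radius is $\mu(\Lambda)=\max_{x\in\mathbf{R}^n}\mathrm{dist}(x,\Lambda)$. *)

theory Defs
  imports "HOL-Probability.Probability"
begin

definition rvecs :: "nat \<Rightarrow> (nat \<Rightarrow> real) set" where
  "rvecs n = {x. \<forall>i\<ge>n. x i = 0}"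

definition vnorm :: "nat \<Rightarrow> (nat \<Rightarrow> real) \<Rightarrow> real" where
  "vnorm n x = sqrt (\<Sum>i<n. (x i)^2)"

definition mat_space :: "nat \<Rightarrow> (nat \<times> nat \<Rightarrow> real) measure" where
  "mat_space n = PiM ({..<n} \<times> {..<n}) (\<lambda>_. lborel)"

definition mdet :: "nat \<Rightarrow> (nat \<times> nat \<Rightarrow> real) \<Rightarrow> real" where
  "mdet n B = (\<Sum>p | p permutes {..<n}. of_int (sign p) * (\<Prod>i<n. B (i, p i)))"

definition mvec :: "nat \<Rightarrow> (nat \<times> nat \<Rightarrow> real) \<Rightarrow> (nat \<Rightarrow> real) \<Rightarrow> (nat \<Rightarrow> real)" where
  "mvec n B x = (\<lambda>i. if i < n then (\<Sum>j<n. B (i, j) * x j) else 0)"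

definition SLn :: "nat \<Rightarrow> (nat \<times> nat \<Rightarrow> real) set" where
  "SLn n = {B \<in> space (mat_space n). mdet n B = 1}"

definition lat :: "nat \<Rightarrow> (nat \<times> nat \<Rightarrow> real) \<Rightarrow> (nat \<Rightarrow> real) set" where
  "lat n B = {mvec n B (\<lambda>j. real_of_int (c j)) | c :: nat \<Rightarrow> int. True}"

text \<open>Unit-covolume lattices in R^n, i.e. SL_n(R)/SL_n(Z).\<close>
definition unimod_lattices :: "nat \<Rightarrow> (nat \<Rightarrow> real) set set" where
  "unimod_lattices n = lat n ` SLn n"

text \<open>Quotient sigma-algebra on SL_n(R)/SL_n(Z) induced by the Borel sets of SL_n(R).\<close>
definition lattice_sets :: "nat \<Rightarrow> (nat \<Rightarrow> real) set set set" where
  "lattice_sets n = {A. A \<subseteq> unimod_lattices n \<and> (lat n -` A \<inter> SLn n) \<in> sets (mat_space n)}"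

text \<open>Siegel's measure: an SL_n(R)-invariant probability measure on SL_n(R)/SL_n(Z)
  (by the uniqueness of the invariant probability measure this is exactly nu_n).\<close>
definition siegel_measure :: "nat \<Rightarrow> (nat \<Rightarrow> real) set measure \<Rightarrow> bool" where
  "siegel_measure n \<nu> \<longleftrightarrow>
     prob_space \<nu> \<and> space \<nu> = unimod_lattices n \<and> sets \<nu> = lattice_sets n \<and>
     (\<forall>g \<in> SLn n. \<forall>A \<in> sets \<nu>. emeasure \<nu> ((\<lambda>L. mvec n g ` L) ` A) = emeasure \<nu> A)"

definition covering_radius :: "nat \<Rightarrow> (nat \<Rightarrow> real) set \<Rightarrow> real" where
  "covering_radius n L = (SUP x \<in> rvecs n. INF v \<in> L. vnorm n (x - v))"

end

theory Submission
  imports Defs "Jordan_Normal_Form.Determinant" "HOL-Real_Asymp.Real_Asymp"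
begin

text \<open>
  Let \<open>K = [-1,1]\<^sup>n\<close>, of volume \<open>2\<^sup>n\<close>, and let \<open>f(w)\<close> be the volume of \<open>K \<inter> (K + w)\<close>. For a unimodular
  lattice \<open>L\<close> the periodization of the indicator of \<open>K\<close> has mean \<open>2\<^sup>n\<close> on the torus and second moment
  \<open>2\<^sup>n + F(L)\<close>, where \<open>F(L)\<close> is the sum of \<open>f\<close> over the nonzero vectors of \<open>L\<close>; hence
  \<open>F(L) \<ge> 4\<^sup>n - 2\<^sup>n\<close>. If some \<open>x\<close> is not covered by \<open>L + [-2,2]\<^sup>n\<close>, the periodizations of \<open>K\<close> and \<open>x - K\<close>
  have disjoint supports, and Cauchy--Schwarz for their sum gives \<open>F(L) \<ge> 2 * 4\<^sup>n - 2\<^sup>n\<close>.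
  Siegel's mean value theorem bounds the expectation of \<open>F\<close> by \<open>4\<^sup>n\<close>, so by Markov's inequality for the
  nonnegative variable \<open>F - (4\<^sup>n - 2\<^sup>n)\<close> the second case has probability at most \<open>2 ^ (-n)\<close>.

  For the mean value theorem only the upper bound is needed, and no reduction theory. By invariance the
  integral of \<open>min F C\<close> is at most that of \<open>min (A\<^sub>T F) C\<close>, where \<open>A\<^sub>T\<close> averages over finitely many
  points of an expanding horosphere. For each fixed lattice the limit superior of \<open>A\<^sub>T F\<close> is at most the
  integral of \<open>f\<close>, by comparing a lattice sum with an integral, and the truncation lets the limit pass under
  the integral.
\<close>

section \<open>Volume preservation by matrices of determinant one\<close>

abbreviation Leb :: "nat set \<Rightarrow> (nat \<Rightarrow> real) measure" where
  "Leb I \<equiv> PiM I (\<lambda>_. lborel)"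

text \<open>Points of \<open>mat_space n\<close> are extensional functions, hence the restriction to
  the index square.\<close>

definition mmul :: "nat \<Rightarrow> (nat \<times> nat \<Rightarrow> real) \<Rightarrow> (nat \<times> nat \<Rightarrow> real) \<Rightarrow> nat \<times> nat \<Rightarrow> real" where
  "mmul n A B = (\<lambda>p\<in>{..<n} \<times> {..<n}. \<Sum>k<n. A (fst p, k) * B (k, snd p))"

text \<open>The same linear map as \<open>mvec\<close>, but its values are points of
  \<open>Leb {..<n}\<close>: undefined instead of zero outside \<open>{..<n}\<close>. Integration
  uses \<open>lin\<close>, lattice vectors use \<open>mvec\<close>.\<close>

definition lin :: "nat \<Rightarrow> (nat \<times> nat \<Rightarrow> real) \<Rightarrow> (nat \<Rightarrow> real) \<Rightarrow> nat \<Rightarrow> real" where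
  "lin n B y = (\<lambda>i\<in>{..<n}. \<Sum>j<n. B (i, j) * y j)"

lemma mdet_eq_det: "mdet n B = Determinant.det (mat n n B)"
proof -
  have "(\<Prod>i<n. B (i, p i)) = (\<Prod>i = 0..<n. mat n n B $$ (i, p i))" if "p permutes {..<n}" for p
    using permutes_in_image[OF that] by (auto intro!: prod.cong simp: lessThan_atLeast0)
  then show ?thesis
    unfolding mdet_def by (subst det_def'[of _ n]) (auto intro!: sum.cong simp: lessThan_atLeast0)
qed

lemma mdet_mmul: "mdet n (mmul n A B) = mdet n A * mdet n B"
proof -
  have "mat n n (mmul n A B) = mat n n A * mat n n B"
    by (rule eq_matI) (auto simp: mmul_def scalar_prod_def lessThan_atLeast0)
  then show ?thesis
    by (simp add: mdet_eq_det det_mult[of _ n])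
qed

lemma mvec_mmul: "mvec n (mmul n A B) x = mvec n A (mvec n B x)"
proof
  fix i
  have "(\<Sum>j<n. (\<Sum>k<n. A (i, k) * B (k, j)) * x j) = (\<Sum>k<n. A (i, k) * (\<Sum>j<n. B (k, j) * x j))"
    by (simp add: sum_distrib_left sum_distrib_right mult.assoc) (rule sum.swap)
  then show "mvec n (mmul n A B) x i = mvec n A (mvec n B x) i"
    by (simp add: mvec_def mmul_def)
qed

lemma mvec_in_rvecs [simp]: "mvec n B x \<in> rvecs n"
  by (simp add: mvec_def rvecs_def)

lemma mmul_in_space: "mmul n A B \<in> space (mat_space n)"
  by (auto simp: mat_space_def space_PiM mmul_def)

lemma mmul_SLn: "A \<in> SLn n \<Longrightarrow> B \<in> SLn n \<Longrightarrow> mmul n A B \<in> SLn n"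
  by (simp add: SLn_def mmul_in_space mdet_mmul)

text \<open>A nonidentity permutation moves at least two indices, so it sends some moved index to a
  column other than \<open>k\<close>, where the entry vanishes. Only the identity survives in the
  Leibniz sum.\<close>

lemma mdet_arrow:
  assumes k: "k < n" and arrow: "\<And>i j. i < n \<Longrightarrow> j < n \<Longrightarrow> i \<noteq> j \<Longrightarrow> j \<noteq> k \<Longrightarrow> B (i, j) = 0"
  shows "mdet n B = (\<Prod>i<n. B (i, i))"
proof -
  have "(\<Prod>i<n. B (i, p i)) = 0" if p: "p permutes {..<n}" and "p \<noteq> id" for p
  proof -
    obtain a where a: "p a \<noteq> a" using \<open>p \<noteq> id\<close> by (auto simp: fun_eq_iff)
    have lt: "p i < n \<longleftrightarrow> i < n" for i using permutes_in_image[OF p] by auto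
    have "a < n" using a p permutes_not_in[OF p, of a] by auto
    obtain i where i: "i < n" "p i \<noteq> i" "p i \<noteq> k"
    proof (cases "p a = k")
      case True
      have "p k \<noteq> k" using a True permutes_inj[OF p] by (metis injD)
      then show ?thesis using that[of k] k by auto
    qed (use that \<open>a < n\<close> a in auto)
    then have "B (i, p i) = 0" using lt[of i] by (intro arrow) auto
    then show ?thesis using i(1) by (auto intro: prod_zero)
  qed
  then have "mdet n B = (\<Sum>p\<in>{id}. of_int (sign p) * (\<Prod>i<n. B (i, p i)))"
    unfolding mdet_def by (intro sum.mono_neutral_right) (auto simp: finite_permutations permutes_id)
  then show ?thesis by simp
qed

lemma mdet_nonzero_inj:
  assumes det: "mdet n B \<noteq> 0" and zero: "\<And>i. i < n \<Longrightarrow> (\<Sum>j<n. B (i, j) * v j) = 0" and "j < n"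
  shows "v j = 0"
proof -
  have "mat n n B *\<^sub>v vec n v = 0\<^sub>v n"
    by (rule eq_vecI) (auto simp: scalar_prod_def zero lessThan_atLeast0[symmetric])
  moreover have "\<not> (\<exists>v. v \<in> carrier_vec n \<and> v \<noteq> 0\<^sub>v n \<and> mat n n B *\<^sub>v v = 0\<^sub>v n)"
    using det det_0_iff_vec_prod_zero[of "mat n n B" n] by (simp add: mdet_eq_det)
  ultimately have "vec n v = 0\<^sub>v n" by (metis vec_carrier)
  then show ?thesis using \<open>j < n\<close> by (metis index_vec index_zero_vec(1))
qed

text \<open>The identities are confined to \<open>rvecs n\<close> because \<open>mvec\<close>
  replaces the coordinates from \<open>n\<close> on by zero.\<close>

lemma SLn_inverse:
  assumes B: "B \<in> SLn n"
  obtains B' where "B' \<in> SLn n"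
    "\<And>x. x \<in> rvecs n \<Longrightarrow> mvec n B (mvec n B' x) = x" "\<And>x. x \<in> rvecs n \<Longrightarrow> mvec n B' (mvec n B x) = x"
proof -
  let ?M = "mat n n B"
  have det: "Determinant.det ?M = 1" using B by (simp add: SLn_def mdet_eq_det)
  obtain C where C: "C \<in> carrier_mat n n" "?M * C = 1\<^sub>m n" "C * ?M = 1\<^sub>m n"
    using det_non_zero_imp_unit[of ?M n] det
    by (auto simp: Units_def ring_mat_def)
  define B' where "B' = (\<lambda>p\<in>{..<n} \<times> {..<n}. C $$ p)"
  have eC: "mat n n B' = C" using C(1) by (intro eq_matI) (auto simp: B'_def)
  have e: "mvec n M (mvec n M' x) = x" if "mat n n M * mat n n M' = 1\<^sub>m n" "x \<in> rvecs n" for M M' x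
  proof
    fix i
    have "mmul n M M' (i, j) = of_bool (i = j)" if "i < n" "j < n" for j
    proof -
      have "(mat n n M * mat n n M') $$ (i, j) = of_bool (i = j)"
        using that \<open>mat n n M * mat n n M' = 1\<^sub>m n\<close> by simp
      then show ?thesis using that
        by (simp add: mmul_def scalar_prod_def lessThan_atLeast0)
    qed
    then have "mvec n (mmul n M M') x i = x i"
      using \<open>x \<in> rvecs n\<close> by (auto simp: mvec_def rvecs_def of_bool_def if_distrib[of "\<lambda>t. t * _"] cong: if_cong)
    then show "mvec n M (mvec n M' x) i = x i" by (simp add: mvec_mmul)
  qed
  have "Determinant.det C = 1"
    using det_mult[of ?M n C] C det by simp
  then have "B' \<in> SLn n"
    by (auto simp: SLn_def mdet_eq_det eC) (auto simp: B'_def mat_space_def space_PiM)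
  then show ?thesis using that e[of B B'] e[of B' B] C eC by auto
qed

section \<open>Change of variables under linear maps\<close>

interpretation lborel_prod: product_sigma_finite "\<lambda>_::nat. lborel :: real measure" ..

lemma measurable_nn_integral_fun_upd:
  assumes "finite I" and h [measurable]: "h \<in> borel_measurable (Leb (insert k I))"
  shows "(\<lambda>y. \<integral>\<^sup>+x. h (x(k := y)) \<partial>Leb I) \<in> borel_measurable borel"
proof -
  interpret sigma_finite_measure "Leb I"
    using \<open>finite I\<close> by (rule lborel_prod.sigma_finite)
  have [measurable]: "(\<lambda>p. (snd p)(k := fst p)) \<in> measurable (borel \<Otimes>\<^sub>M Leb I) (Leb (insert k I))"
    by (rule measurable_fun_upd[where J = I]) auto
  show ?thesis by measurable
qed

text \<open>Induction on \<open>I\<close>: with the new coordinate in the outer integral, the inner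
  integral is covered by the induction hypothesis and the outer one by translation invariance on the
  line.\<close>

lemma nn_integral_Leb_translate:
  assumes "finite I" "h \<in> borel_measurable (Leb I)"
  shows "(\<integral>\<^sup>+y. h (\<lambda>i\<in>I. y i + a i) \<partial>Leb I) = (\<integral>\<^sup>+y. h y \<partial>Leb I)"
  using assms
proof (induction I arbitrary: h)
  case empty
  then show ?case by (simp add: nn_integral_count_space_finite PiM_empty)
next
  case (insert k I)
  note [measurable] = insert.prems
  have [measurable]: "(\<lambda>y. \<lambda>i\<in>insert k I. y i + a i) \<in> measurable (Leb (insert k I)) (Leb (insert k I))"
    by measurable
  have e: "(\<lambda>i\<in>insert k I. (x(k := y)) i + a i) = (\<lambda>i\<in>I. x i + a i)(k := y + a k)" for x :: "nat \<Rightarrow> real" and y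
    using insert.hyps by (auto simp: fun_eq_iff restrict_def)
  have upd [measurable]: "(\<lambda>(x, y). x(k := y)) \<in> measurable (Leb I \<Otimes>\<^sub>M lborel) (Leb (insert k I))"
    by (rule measurable_add_dim)
  have "(\<integral>\<^sup>+y. h (\<lambda>i\<in>insert k I. y i + a i) \<partial>Leb (insert k I))
      = (\<integral>\<^sup>+y. \<integral>\<^sup>+x. h (\<lambda>i\<in>insert k I. (x(k := y)) i + a i) \<partial>Leb I \<partial>lborel)"
    by (rule lborel_prod.product_nn_integral_insert_rev) (use insert.hyps in measurable)
  also have "\<dots> = (\<integral>\<^sup>+y. \<integral>\<^sup>+x. h (x(k := y + a k)) \<partial>Leb I \<partial>lborel)"
  proof (rule nn_integral_cong)
    fix y :: real
    have "(\<lambda>x. h (x(k := y + a k))) \<in> borel_measurable (Leb I)" by measurable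
    from insert.IH[OF this]
    show "(\<integral>\<^sup>+x. h (\<lambda>i\<in>insert k I. (x(k := y)) i + a i) \<partial>Leb I) = (\<integral>\<^sup>+x. h (x(k := y + a k)) \<partial>Leb I)"
      by (simp only: e)
  qed
  also have "\<dots> = (\<integral>\<^sup>+y. \<integral>\<^sup>+x. h (x(k := y)) \<partial>Leb I \<partial>lborel)"
    using nn_integral_real_affine[of "\<lambda>y. \<integral>\<^sup>+x. h (x(k := y)) \<partial>Leb I" 1 "a k"]
      measurable_nn_integral_fun_upd[OF insert.hyps(1) insert.prems]
    by (simp add: add.commute)
  also have "\<dots> = (\<integral>\<^sup>+y. h y \<partial>Leb (insert k I))"
    by (rule lborel_prod.product_nn_integral_insert_rev[symmetric]) (use insert.hyps in measurable)
  finally show ?case .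
qed

lemma measurable_lin [measurable]: "lin n B \<in> measurable (Leb {..<n}) (Leb {..<n})"
  unfolding lin_def by measurable

text \<open>With coordinate \<open>k\<close> held fixed, such a matrix only translates the other
  coordinates. Once the translation is removed, a scaling of the line by \<open>C (k, k)\<close>
  remains.\<close>

lemma nn_integral_arrow:
  assumes k: "k < n" and h [measurable]: "h \<in> borel_measurable (Leb {..<n})"
    and off: "\<And>i j. i < n \<Longrightarrow> j < n \<Longrightarrow> i \<noteq> j \<Longrightarrow> j \<noteq> k \<Longrightarrow> C (i, j) = 0"
    and diag: "\<And>i. i < n \<Longrightarrow> i \<noteq> k \<Longrightarrow> C (i, i) = 1" and nz: "C (k, k) \<noteq> 0"
  shows "(\<integral>\<^sup>+y. h y \<partial>Leb {..<n}) = ennreal \<bar>C (k, k)\<bar> * (\<integral>\<^sup>+y. h (lin n C y) \<partial>Leb {..<n})"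
proof -
  let ?I = "{..<n} - {k}"
  have I: "{..<n} = insert k ?I" using k by auto
  have upd [measurable]: "(\<lambda>(x, y). x(k := y)) \<in> measurable (Leb ?I \<Otimes>\<^sub>M lborel) (Leb {..<n})"
    by (subst (2) I) (rule measurable_add_dim)
  have split: "(\<integral>\<^sup>+y. g y \<partial>Leb {..<n}) = (\<integral>\<^sup>+y. \<integral>\<^sup>+x. g (x(k := y)) \<partial>Leb ?I \<partial>lborel)"
    if "g \<in> borel_measurable (Leb {..<n})" for g
    using lborel_prod.product_nn_integral_insert_rev[of ?I k g] that I by simp
  have e: "lin n C (x(k := y)) = (\<lambda>i\<in>?I. x i + C (i, k) * y)(k := C (k, k) * y)" for x y
  proof
    fix i
    have "(\<Sum>j<n. C (i, j) * (x(k := y)) j) = (if i = k then C (k, k) * y else x i + C (i, k) * y)" if "i < n"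
    proof -
      have "(\<Sum>j<n. C (i, j) * (x(k := y)) j) = (\<Sum>j\<in>{i, k}. C (i, j) * (x(k := y)) j)"
        using that k off by (intro sum.mono_neutral_right) auto
      then show ?thesis using diag[OF that] by (cases "i = k") auto
    qed
    then show "lin n C (x(k := y)) i = ((\<lambda>i\<in>?I. x i + C (i, k) * y)(k := C (k, k) * y)) i"
      using k by (auto simp: lin_def restrict_def)
  qed
  have "(\<integral>\<^sup>+y. h (lin n C y) \<partial>Leb {..<n})
      = (\<integral>\<^sup>+y. \<integral>\<^sup>+x. h ((\<lambda>i\<in>?I. x i + C (i, k) * y)(k := C (k, k) * y)) \<partial>Leb ?I \<partial>lborel)"
    by (subst split) (simp_all only: e, measurable)
  also have "\<dots> = (\<integral>\<^sup>+y. \<integral>\<^sup>+x. h (x(k := C (k, k) * y)) \<partial>Leb ?I \<partial>lborel)"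
    by (intro nn_integral_cong nn_integral_Leb_translate[where h = "\<lambda>x. h (x(k := C (k, k) * _))"]) auto
  finally show ?thesis
    using nn_integral_real_affine[of "\<lambda>y. \<integral>\<^sup>+x. h (x(k := y)) \<partial>Leb ?I" "C (k, k)" 0] nz
      measurable_nn_integral_fun_upd[of ?I h k] I
    by (simp add: split)
qed

lemma lin_mmul: "lin n (mmul n A B) y = lin n A (lin n B y)"
proof
  fix i
  have "(\<Sum>j<n. (\<Sum>k<n. A (i, k) * B (k, j)) * y j) = (\<Sum>k<n. A (i, k) * (\<Sum>j<n. B (k, j) * y j))"
    by (simp add: sum_distrib_left sum_distrib_right mult.assoc) (rule sum.swap)
  then show "lin n (mmul n A B) y i = lin n A (lin n B y) i"
    by (simp add: lin_def mmul_def)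
qed

lemma lin_cong: "(\<And>i j. i < n \<Longrightarrow> j < n \<Longrightarrow> A (i, j) = B (i, j)) \<Longrightarrow> lin n A = lin n B"
  by (auto simp: lin_def fun_eq_iff restrict_def)

text \<open>The change of variables formula, in a form that composes under \<open>mmul\<close> and
  involves no inverse matrix.\<close>

definition scales_Leb :: "nat \<Rightarrow> (nat \<times> nat \<Rightarrow> real) \<Rightarrow> bool" where
  "scales_Leb n B \<longleftrightarrow> (\<forall>h \<in> borel_measurable (Leb {..<n}).
     (\<integral>\<^sup>+y. h y \<partial>Leb {..<n}) = ennreal \<bar>mdet n B\<bar> * (\<integral>\<^sup>+y. h (lin n B y) \<partial>Leb {..<n}))"

lemma scales_Leb_mmul:
  assumes "scales_Leb n A" "scales_Leb n B"
  shows "scales_Leb n (mmul n A B)"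
  unfolding scales_Leb_def
proof
  fix h :: "(nat \<Rightarrow> real) \<Rightarrow> ennreal" assume [measurable]: "h \<in> borel_measurable (Leb {..<n})"
  have "(\<integral>\<^sup>+y. h y \<partial>Leb {..<n}) = ennreal \<bar>mdet n A\<bar> * (\<integral>\<^sup>+y. h (lin n A y) \<partial>Leb {..<n})"
    using assms(1) unfolding scales_Leb_def by (rule bspec) measurable
  also have "(\<integral>\<^sup>+y. h (lin n A y) \<partial>Leb {..<n})
      = ennreal \<bar>mdet n B\<bar> * (\<integral>\<^sup>+y. h (lin n A (lin n B y)) \<partial>Leb {..<n})"
  proof -
    have "(\<lambda>y. h (lin n A y)) \<in> borel_measurable (Leb {..<n})" by measurable
    then show ?thesis using assms(2) unfolding scales_Leb_def by (rule bspec[rotated])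
  qed
  finally show "(\<integral>\<^sup>+y. h y \<partial>Leb {..<n})
      = ennreal \<bar>mdet n (mmul n A B)\<bar> * (\<integral>\<^sup>+y. h (lin n (mmul n A B) y) \<partial>Leb {..<n})"
    by (simp add: lin_mmul mdet_mmul abs_mult ennreal_mult' mult.assoc)
qed

lemma scales_Leb_arrow:
  assumes "k < n"
    and "\<And>i j. i < n \<Longrightarrow> j < n \<Longrightarrow> i \<noteq> j \<Longrightarrow> j \<noteq> k \<Longrightarrow> C (i, j) = 0"
    and "\<And>i. i < n \<Longrightarrow> i \<noteq> k \<Longrightarrow> C (i, i) = 1" and "C (k, k) \<noteq> 0"
  shows "scales_Leb n C" and "mdet n C = C (k, k)"
proof -
  have "(\<Prod>i<n. C (i, i)) = (\<Prod>i\<in>{k}. C (i, i))"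
    using assms by (intro prod.mono_neutral_right) auto
  then show det: "mdet n C = C (k, k)" using mdet_arrow[of k n C] assms by simp
  show "scales_Leb n C"
    unfolding scales_Leb_def det by (intro ballI nn_integral_arrow assms)
qed

lemma mdet_cong: "(\<And>i j. i < n \<Longrightarrow> j < n \<Longrightarrow> A (i, j) = B (i, j)) \<Longrightarrow> mdet n A = mdet n B"
  unfolding mdet_eq_det by (rule arg_cong[where f = Determinant.det]) auto

text \<open>A factorization through \<open>mmul\<close> is only an equality of entries inside the
  index square; this carries the formula from the product to the original matrix.\<close>

lemma scales_Leb_cong:
  assumes "\<And>i j. i < n \<Longrightarrow> j < n \<Longrightarrow> A (i, j) = B (i, j)"
  shows "scales_Leb n A \<longleftrightarrow> scales_Leb n B"
proof -
  have "lin n A = lin n B" by (rule lin_cong) (rule assms)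
  moreover have "mdet n A = mdet n B" by (rule mdet_cong) (rule assms)
  ultimately show ?thesis by (simp add: scales_Leb_def)
qed

text \<open>Gaussian elimination, one column at a time: a nonsingular matrix whose last columns are unit
  vectors splits off a factor that is the identity except for one column.\<close>

lemma scales_Leb_unit_columns:
  assumes "k \<le> n" "mdet n B \<noteq> 0"
    and "\<And>i j. i < n \<Longrightarrow> k \<le> j \<Longrightarrow> j < n \<Longrightarrow> B (i, j) = of_bool (i = j)"
  shows "scales_Leb n B"
  using assms
proof (induction k arbitrary: B)
  case 0
  show ?case
  proof (cases "n = 0")
    case True
    then show ?thesis
      using 0 by (simp add: scales_Leb_def mdet_def lin_def PiM_empty nn_integral_count_space_finite restrict_def)
  next
    case False
    then show ?thesis using 0 by (intro scales_Leb_arrow(1)[of 0]) auto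
  qed
next
  case (Suc k)
  have k: "k < n" using Suc.prems by simp
  have pivot: "scales_Leb n B"
    if det: "mdet n B \<noteq> 0" and nz: "B (k, k) \<noteq> 0"
      and unit: "\<And>i j. i < n \<Longrightarrow> Suc k \<le> j \<Longrightarrow> j < n \<Longrightarrow> B (i, j) = of_bool (i = j)" for B
  proof -
    \<comment> \<open>\<open>C\<close> is the identity with column \<open>k\<close> taken from
      \<open>B\<close>, and \<open>B'\<close> is the inverse of \<open>C\<close> applied to
      \<open>B\<close>: column \<open>k\<close> becomes a unit column and the later ones
      stay.\<close>
    define C where "C = (\<lambda>(i, j). if j = k then B (i, k) else of_bool (i = j) :: real)"
    define B' where "B' = (\<lambda>(i, j). if i = k then B (k, j) / B (k, k) else B (i, j) - B (i, k) * B (k, j) / B (k, k))"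
    have C: "scales_Leb n C" "mdet n C = C (k, k)"
      by (rule scales_Leb_arrow[OF k]; simp add: C_def nz)+
    have eq: "mmul n C B' (i, j) = B (i, j)" if "i < n" "j < n" for i j
    proof -
      have "(\<Sum>l<n. C (i, l) * B' (l, j)) = (\<Sum>l\<in>{i, k}. C (i, l) * B' (l, j))"
        using k that by (intro sum.mono_neutral_right) (auto simp: C_def)
      also have "\<dots> = B (i, j)" using nz by (cases "i = k") (auto simp: C_def B'_def field_simps)
      finally show ?thesis using that by (simp add: mmul_def)
    qed
    have "mdet n B = mdet n C * mdet n B'"
      using mdet_cong[of n "mmul n C B'" B] eq by (simp add: mdet_mmul)
    then have "mdet n B' \<noteq> 0" using det by auto
    moreover have "B' (i, j) = of_bool (i = j)" if "i < n" "k \<le> j" "j < n" for i j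
      using that k nz unit[of i j] unit[of k j] by (cases "j = k") (auto simp: B'_def)
    ultimately have "scales_Leb n B'" using k by (intro Suc.IH) simp_all
    with C have "scales_Leb n (mmul n C B')" by (intro scales_Leb_mmul)
    then show ?thesis using scales_Leb_cong[of n "mmul n C B'" B] eq by simp
  qed
  show ?case
  proof (cases "B (k, k) = 0")
    case False
    then show ?thesis using Suc.prems by (intro pivot) auto
  next
    case True
    have "\<exists>i<k. B (i, k) \<noteq> 0"
    proof (rule ccontr)
      assume none: "\<not> (\<exists>i<k. B (i, k) \<noteq> 0)"
      \<comment> \<open>Column \<open>k\<close> would then be supported on row indices larger than
        \<open>k\<close>, hence be a combination of the later unit columns; \<open>v\<close> records
        this linear dependence.\<close>
      define v where "v = (\<lambda>j. if j = k then 1 else if j < k then 0 else - B (j, k))"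
      have "(\<Sum>j<n. B (i, j) * v j) = 0" if "i < n" for i
      proof -
        have "(\<Sum>j<n. B (i, j) * v j) = (\<Sum>j\<in>{i, k}. B (i, j) * v j)"
        proof (rule sum.mono_neutral_right)
          show "\<forall>j\<in>{..<n} - {i, k}. B (i, j) * v j = 0"
          proof
            fix j assume j: "j \<in> {..<n} - {i, k}"
            show "B (i, j) * v j = 0"
            proof (cases "j < k")
              case True
              then show ?thesis by (simp add: v_def)
            next
              case False
              then have "B (i, j) = of_bool (i = j)" using j that by (intro Suc.prems(3)) auto
              then show ?thesis using j by simp
            qed
          qed
        qed (use k that in auto)
        also have "\<dots> = 0"
        proof (cases i k rule: linorder_cases)
          case greater
          then have "B (i, i) = 1" using Suc.prems(3)[of i i] that by simp
          with greater show ?thesis by (simp add: v_def)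
        qed (use none True in \<open>simp_all add: v_def\<close>)
        finally show ?thesis .
      qed
      then have "v k = 0" using mdet_nonzero_inj[of n B v k] Suc.prems k by auto
      then show False by (simp add: v_def)
    qed
    then obtain i where i: "i < k" "B (i, k) \<noteq> 0" by auto
    \<comment> \<open>\<open>B'\<close> adds row \<open>i\<close> to row \<open>k\<close>, which
      makes the pivot \<open>B (i, k)\<close>, and \<open>S\<close> undoes this. The later unit
      columns are unaffected, since row \<open>i\<close> vanishes there.\<close>
    define S where "S = (\<lambda>(a, b). of_bool (a = b) - of_bool (a = k \<and> b = i) :: real)"
    define B' where "B' = (\<lambda>(a, b). B (a, b) + of_bool (a = k) * B (i, b))"
    have "i < n" using i k by simp
    have S: "scales_Leb n S" "mdet n S = S (i, i)"
      by (rule scales_Leb_arrow[OF \<open>i < n\<close>]; use i in \<open>simp add: S_def\<close>)+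
    have eq: "mmul n S B' (a, b) = B (a, b)" if "a < n" "b < n" for a b
    proof -
      have "(\<Sum>l<n. S (a, l) * B' (l, b)) = (\<Sum>l\<in>{a, i}. S (a, l) * B' (l, b))"
        using i k that by (intro sum.mono_neutral_right) (auto simp: S_def)
      also have "\<dots> = B (a, b)" using i by (cases "a = i") (auto simp: S_def B'_def)
      finally show ?thesis using that by (simp add: mmul_def)
    qed
    have "mdet n B = mdet n S * mdet n B'"
      using mdet_cong[of n "mmul n S B'" B] eq by (simp add: mdet_mmul)
    then have "mdet n B' \<noteq> 0" using Suc.prems(2) by auto
    moreover have "B' (a, b) = of_bool (a = b)" if "a < n" "Suc k \<le> b" "b < n" for a b
      using that i k Suc.prems(3)[of a b] Suc.prems(3)[of i b] by (auto simp: B'_def)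
    moreover have "B' (k, k) \<noteq> 0" using i True by (simp add: B'_def)
    ultimately have "scales_Leb n B'" by (intro pivot) simp_all
    with S have "scales_Leb n (mmul n S B')" by (intro scales_Leb_mmul)
    then show ?thesis using scales_Leb_cong[of n "mmul n S B'" B] eq by simp
  qed
qed

lemma nn_integral_lin:
  assumes "mdet n B = 1" "h \<in> borel_measurable (Leb {..<n})"
  shows "(\<integral>\<^sup>+y. h (lin n B y) \<partial>Leb {..<n}) = (\<integral>\<^sup>+y. h y \<partial>Leb {..<n})"
proof -
  have "scales_Leb n B" using assms by (intro scales_Leb_unit_columns[of n]) auto
  then have "(\<integral>\<^sup>+y. h y \<partial>Leb {..<n}) = ennreal \<bar>mdet n B\<bar> * (\<integral>\<^sup>+y. h (lin n B y) \<partial>Leb {..<n})"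
    using assms(2) unfolding scales_Leb_def by (rule bspec)
  then show ?thesis using assms(1) by simp
qed

section \<open>Periodization over a lattice\<close>

lemma borel_measurable_nn_integral_count_space:
  assumes "countable I" "\<And>i. i \<in> I \<Longrightarrow> f i \<in> borel_measurable M"
  shows "(\<lambda>x. \<integral>\<^sup>+i. f i x \<partial>count_space I) \<in> borel_measurable M"
proof -
  interpret sigma_finite_measure "count_space I"
    using assms(1) by (rule sigma_finite_measure_count_space_countable)
  have "(\<lambda>(i, x). f i x) \<in> borel_measurable (count_space I \<Otimes>\<^sub>M M)"
    using assms by (intro measurable_pair_measure_countable1) auto
  then have "(\<lambda>(x, i). f i x) \<in> borel_measurable (M \<Otimes>\<^sub>M count_space I)"
    using measurable_pair_swap by fastforce
  then show ?thesis by (rule borel_measurable_nn_integral)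
qed

text \<open>\<open>mvec\<close> reads only the first \<open>n\<close> coefficients. Extensional
  coefficient vectors make the parametrization of a lattice by a basis injective.\<close>

definition Zn :: "nat \<Rightarrow> (nat \<Rightarrow> int) set" where
  "Zn n = PiE {..<n} (\<lambda>_. UNIV)"

definition lvec :: "nat \<Rightarrow> (nat \<times> nat \<Rightarrow> real) \<Rightarrow> (nat \<Rightarrow> int) \<Rightarrow> nat \<Rightarrow> real" where
  "lvec n B c = mvec n B (\<lambda>j. real_of_int (c j))"

definition zshift :: "nat \<Rightarrow> (nat \<Rightarrow> real) \<Rightarrow> (nat \<Rightarrow> int) \<Rightarrow> nat \<Rightarrow> real" where
  "zshift n u c = (\<lambda>i\<in>{..<n}. u i + real_of_int (c i))"

definition unit_cube :: "nat \<Rightarrow> (nat \<Rightarrow> real) set" where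
  "unit_cube n = PiE {..<n} (\<lambda>_. {0..<1})"

lemma countable_Zn [simp]: "countable (Zn n)"
  unfolding Zn_def by (intro countable_PiE) auto

lemma lat_eq: "lat n B = lvec n B ` Zn n"
proof (intro equalityI subsetI)
  fix w assume "w \<in> lat n B"
  then obtain c :: "nat \<Rightarrow> int" where w: "w = lvec n B c"
    by (auto simp: lat_def lvec_def)
  have "lvec n B c = lvec n B (\<lambda>i\<in>{..<n}. c i)" by (simp add: lvec_def mvec_def fun_eq_iff)
  then show "w \<in> lvec n B ` Zn n" using w by (auto simp: Zn_def)
qed (auto simp: lat_def lvec_def)

lemma lvec_inj:
  assumes "mdet n B \<noteq> 0"
  shows "inj_on (lvec n B) (Zn n)"
proof (rule inj_onI)
  fix c d assume c: "c \<in> Zn n" "d \<in> Zn n" and eq: "lvec n B c = lvec n B d"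
  have "(\<Sum>j<n. B (i, j) * (real_of_int (c j) - real_of_int (d j))) = 0" if "i < n" for i
    using fun_cong[OF eq, of i] that by (simp add: lvec_def mvec_def algebra_simps sum_subtractf)
  then have "real_of_int (c j) - real_of_int (d j) = 0" if "j < n" for j
    using mdet_nonzero_inj[OF assms _ that, of "\<lambda>j. real_of_int (c j) - real_of_int (d j)"] by auto
  then show "c = d"
    using c by (intro PiE_ext[of c "{..<n}" "\<lambda>_. UNIV" d]) (auto simp: Zn_def)
qed

lemma unit_cube_sets [measurable]: "unit_cube n \<in> sets (Leb {..<n})"
  unfolding unit_cube_def by (intro sets_PiM_I_finite) auto

lemma measurable_zshift [measurable]: "(\<lambda>u. zshift n u c) \<in> measurable (Leb {..<n}) (Leb {..<n})"
  unfolding zshift_def by measurable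

lemma emeasure_unit_cube: "emeasure (Leb {..<n}) (unit_cube n) = 1"
  unfolding unit_cube_def by (subst lborel_prod.emeasure_PiM) auto

text \<open>The integer translates of the half-open unit cube tile space; the one containing
  \<open>y\<close> is indexed by the floors of the coordinates of \<open>y\<close>. Insert this
  partition of unity, exchange sum and integral, and translate each piece back.\<close>

lemma nn_integral_unfold:
  assumes [measurable]: "H \<in> borel_measurable (Leb {..<n})"
  shows "(\<integral>\<^sup>+c. \<integral>\<^sup>+u. H (zshift n u c) * indicator (unit_cube n) u \<partial>Leb {..<n} \<partial>count_space (Zn n))
    = (\<integral>\<^sup>+y. H y \<partial>Leb {..<n})"
proof -
  let ?m = "\<lambda>c i. - c i :: int"
  have one: "(\<integral>\<^sup>+c. H y * indicator (unit_cube n) (zshift n y (?m c)) \<partial>count_space (Zn n)) = H y"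
    if y: "y \<in> space (Leb {..<n})" for y
  proof -
    let ?c = "\<lambda>i\<in>{..<n}. \<lfloor>y i\<rfloor>"
    have c: "?c \<in> Zn n" by (auto simp: Zn_def)
    have iff: "zshift n y (?m c) \<in> unit_cube n \<longleftrightarrow> c = ?c" if "c \<in> Zn n" for c
    proof
      assume a: "zshift n y (?m c) \<in> unit_cube n"
      have "c i = \<lfloor>y i\<rfloor>" if "i < n" for i
        using a that unfolding unit_cube_def zshift_def
        by (auto simp: PiE_iff intro!: floor_unique[symmetric])
           (metis diff_less_eq lessThan_iff add.commute)
      then show "c = ?c"
        using \<open>c \<in> Zn n\<close> by (intro PiE_ext[of c "{..<n}" "\<lambda>_. UNIV" ?c]) (auto simp: Zn_def)
    next
      assume c: "c = ?c"
      show "zshift n y (?m c) \<in> unit_cube n"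
        unfolding unit_cube_def zshift_def c by (auto simp: PiE_iff) linarith+
    qed
    have "(\<integral>\<^sup>+c. H y * indicator (unit_cube n) (zshift n y (?m c)) \<partial>count_space (Zn n))
        = (\<Sum>c\<in>{?c}. H y * indicator (unit_cube n) (zshift n y (?m c)))"
      using c iff by (intro nn_integral_count_space') auto
    also have "\<dots> = H y" using iff[OF c] by simp
    finally show ?thesis .
  qed
  have "(\<integral>\<^sup>+y. H y \<partial>Leb {..<n})
      = (\<integral>\<^sup>+y. \<integral>\<^sup>+c. H y * indicator (unit_cube n) (zshift n y (?m c)) \<partial>count_space (Zn n) \<partial>Leb {..<n})"
    by (intro nn_integral_cong) (simp add: one)
  also have "\<dots> = (\<integral>\<^sup>+c. \<integral>\<^sup>+y. H y * indicator (unit_cube n) (zshift n y (?m c)) \<partial>Leb {..<n} \<partial>count_space (Zn n))"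
    by (intro nn_integral_count_space_nn_integral) auto
  also have "\<dots> = (\<integral>\<^sup>+c. \<integral>\<^sup>+u. H (zshift n u c) * indicator (unit_cube n) u \<partial>Leb {..<n} \<partial>count_space (Zn n))"
  proof (rule nn_integral_cong)
    fix c
    have "(\<integral>\<^sup>+y. H y * indicator (unit_cube n) (zshift n y (?m c)) \<partial>Leb {..<n})
        = (\<integral>\<^sup>+u. H (zshift n u c) * indicator (unit_cube n) (zshift n (zshift n u c) (?m c)) \<partial>Leb {..<n})"
      unfolding zshift_def
      by (rule nn_integral_Leb_translate[symmetric]) (auto simp flip: zshift_def)
    also have "\<dots> = (\<integral>\<^sup>+u. H (zshift n u c) * indicator (unit_cube n) u \<partial>Leb {..<n})"
    proof (rule nn_integral_cong)
      fix u assume "u \<in> space (Leb {..<n})"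
      then have "zshift n (zshift n u c) (?m c) = u"
        by (auto simp: zshift_def space_PiM PiE_iff extensional_def restrict_def fun_eq_iff)
      then show "H (zshift n u c) * indicator (unit_cube n) (zshift n (zshift n u c) (?m c))
          = H (zshift n u c) * indicator (unit_cube n) u" by simp
    qed
    finally show "(\<integral>\<^sup>+y. H y * indicator (unit_cube n) (zshift n y (?m c)) \<partial>Leb {..<n})
        = (\<integral>\<^sup>+u. H (zshift n u c) * indicator (unit_cube n) u \<partial>Leb {..<n})" .
  qed
  finally show ?thesis ..
qed

definition vadd :: "nat \<Rightarrow> (nat \<Rightarrow> real) \<Rightarrow> (nat \<Rightarrow> real) \<Rightarrow> nat \<Rightarrow> real" where
  "vadd n v w = (\<lambda>i\<in>{..<n}. v i + w i)"

lemma measurable_vadd [measurable]: "(\<lambda>v. vadd n v w) \<in> measurable (Leb {..<n}) (Leb {..<n})"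
  unfolding vadd_def by measurable

lemma lin_zshift: "lin n B (zshift n u c) = vadd n (lin n B u) (lvec n B c)"
  by (auto simp: lin_def zshift_def vadd_def lvec_def mvec_def fun_eq_iff algebra_simps sum.distrib restrict_def)

definition zadd :: "nat \<Rightarrow> (nat \<Rightarrow> int) \<Rightarrow> (nat \<Rightarrow> int) \<Rightarrow> nat \<Rightarrow> int" where
  "zadd n c e = (\<lambda>i\<in>{..<n}. c i + e i)"

lemma bij_betw_zadd: "bij_betw (zadd n c) (Zn n) (Zn n)"
  by (rule bij_betw_byWitness[where f' = "\<lambda>d. zadd n d (\<lambda>i. - c i)"])
     (auto simp: zadd_def Zn_def PiE_iff extensional_def fun_eq_iff restrict_def)

lemma zshift_zadd: "zshift n u (zadd n c e) = zshift n (zshift n u c) e"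
  by (auto simp: zshift_def zadd_def fun_eq_iff restrict_def)

text \<open>Cauchy--Schwarz on the torus for the periodization of \<open>\<phi>\<close>; the right-hand side is its
  second moment.\<close>

lemma periodization_second_moment:
  assumes det: "mdet n B = 1" and [measurable]: "\<phi> \<in> borel_measurable (Leb {..<n})"
  shows "(\<integral>\<^sup>+v. \<phi> v \<partial>Leb {..<n})\<^sup>2
    \<le> (\<integral>\<^sup>+e. \<integral>\<^sup>+v. \<phi> v * \<phi> (vadd n v (lvec n B e)) \<partial>Leb {..<n} \<partial>count_space (Zn n))"
proof -
  let ?L = "Leb {..<n}" and ?Q = "unit_cube n" and ?C = "count_space (Zn n)"
  define g where "g = (\<lambda>u. \<phi> (lin n B u))"
  have [measurable]: "g \<in> borel_measurable ?L" unfolding g_def by measurable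
  define N where "N = (\<lambda>u. \<integral>\<^sup>+c. g (zshift n u c) \<partial>?C)"
  have [measurable]: "N \<in> borel_measurable ?L"
    unfolding N_def by (rule borel_measurable_nn_integral_count_space) auto
  have "(\<integral>\<^sup>+v. \<phi> v \<partial>?L) = (\<integral>\<^sup>+y. g y \<partial>?L)"
    unfolding g_def by (rule nn_integral_lin[symmetric]) (use det in auto)
  also have "\<dots> = (\<integral>\<^sup>+c. \<integral>\<^sup>+u. g (zshift n u c) * indicator ?Q u \<partial>?L \<partial>?C)"
    by (rule nn_integral_unfold[symmetric]) simp
  also have "\<dots> = (\<integral>\<^sup>+u. \<integral>\<^sup>+c. g (zshift n u c) * indicator ?Q u \<partial>?C \<partial>?L)"
    by (intro nn_integral_count_space_nn_integral[symmetric]) auto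
  also have "\<dots> = (\<integral>\<^sup>+u. (N u * indicator ?Q u) * indicator ?Q u \<partial>?L)"
    by (intro nn_integral_cong) (auto simp: N_def indicator_def)
  \<comment> \<open>The cube has volume one, so Cauchy--Schwarz against its indicator loses no
    constant.\<close>
  finally have "(\<integral>\<^sup>+v. \<phi> v \<partial>?L)\<^sup>2 \<le> (\<integral>\<^sup>+u. (N u * indicator ?Q u)\<^sup>2 \<partial>?L) * (\<integral>\<^sup>+u. (indicator ?Q u)\<^sup>2 \<partial>?L)"
    using Cauchy_Schwarz_nn_integral[of "\<lambda>u. N u * indicator ?Q u" ?L "indicator ?Q"] by simp
  also have "(\<integral>\<^sup>+u. (indicator ?Q u)\<^sup>2 \<partial>?L) = (\<integral>\<^sup>+u. indicator ?Q u \<partial>?L)"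
    by (intro nn_integral_cong) (auto simp: indicator_def)
  also have "\<dots> = 1" by (simp add: emeasure_unit_cube)
  also have "(\<integral>\<^sup>+u. (N u * indicator ?Q u)\<^sup>2 \<partial>?L)
      = (\<integral>\<^sup>+u. \<integral>\<^sup>+e. \<integral>\<^sup>+c. g (zshift n u c) * g (zshift n (zshift n u c) e) * indicator ?Q u \<partial>?C \<partial>?C \<partial>?L)"
  proof (rule nn_integral_cong)
    fix u
    have "N u * N u = (\<integral>\<^sup>+c. g (zshift n u c) * N u \<partial>?C)"
      unfolding N_def by (rule nn_integral_multc[symmetric]) simp
    also have "\<dots> = (\<integral>\<^sup>+c. \<integral>\<^sup>+e. g (zshift n u c) * g (zshift n (zshift n u c) e) \<partial>?C \<partial>?C)"
    proof (rule nn_integral_cong)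
      fix c
      \<comment> \<open>Reindexing the second sum by the difference \<open>e\<close> leaves
        \<open>c\<close> as the variable that unfolds the cube to the whole space.\<close>
      have "N u = (\<integral>\<^sup>+e. g (zshift n u (zadd n c e)) \<partial>?C)"
        unfolding N_def by (rule nn_integral_bij_count_space[OF bij_betw_zadd, symmetric])
      then show "g (zshift n u c) * N u = (\<integral>\<^sup>+e. g (zshift n u c) * g (zshift n (zshift n u c) e) \<partial>?C)"
        by (simp add: zshift_zadd nn_integral_cmult)
    qed
    also have "\<dots> = (\<integral>\<^sup>+e. \<integral>\<^sup>+c. g (zshift n u c) * g (zshift n (zshift n u c) e) \<partial>?C \<partial>?C)"
      by (intro nn_integral_count_space_nn_integral) auto
    finally show "(N u * indicator ?Q u)\<^sup>2
        = (\<integral>\<^sup>+e. \<integral>\<^sup>+c. g (zshift n u c) * g (zshift n (zshift n u c) e) * indicator ?Q u \<partial>?C \<partial>?C)"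
      by (auto simp: power2_eq_square indicator_def)
  qed
  also have "\<dots> = (\<integral>\<^sup>+e. \<integral>\<^sup>+u. \<integral>\<^sup>+c. g (zshift n u c) * g (zshift n (zshift n u c) e) * indicator ?Q u \<partial>?C \<partial>?L \<partial>?C)"
    by (intro nn_integral_count_space_nn_integral) (auto intro!: borel_measurable_nn_integral_count_space)
  also have "\<dots> = (\<integral>\<^sup>+e. \<integral>\<^sup>+c. \<integral>\<^sup>+u. g (zshift n u c) * g (zshift n (zshift n u c) e) * indicator ?Q u \<partial>?L \<partial>?C \<partial>?C)"
    by (intro nn_integral_cong nn_integral_count_space_nn_integral) auto
  also have "\<dots> = (\<integral>\<^sup>+e. \<integral>\<^sup>+y. g y * g (zshift n y e) \<partial>?L \<partial>?C)"
    by (intro nn_integral_cong nn_integral_unfold) auto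
  also have "\<dots> = (\<integral>\<^sup>+e. \<integral>\<^sup>+v. \<phi> v * \<phi> (vadd n v (lvec n B e)) \<partial>?L \<partial>?C)"
    unfolding g_def lin_zshift
    by (intro nn_integral_cong nn_integral_lin[where h = "\<lambda>v. \<phi> v * \<phi> (vadd n v (lvec n B _))"]) (use det in auto)
  finally show ?thesis by simp
qed

section \<open>Lattice sums and covering\<close>

text \<open>This is the function \<open>f\<close> of the overview, the overlap volume of the cube
  with its translate by \<open>w\<close>; see \<open>nn_integral_box_overlap\<close>.\<close>

definition tent :: "nat \<Rightarrow> (nat \<Rightarrow> real) \<Rightarrow> ennreal" where
  "tent n w = (\<Prod>i<n. ennreal (max 0 (2 - \<bar>w i\<bar>)))"

definition box :: "nat \<Rightarrow> (nat \<Rightarrow> real) \<Rightarrow> (nat \<Rightarrow> real) \<Rightarrow> ennreal" where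
  "box n a v = (\<Prod>i<n. indicator {a i - 1..a i + 1} (v i))"

lemma measurable_box [measurable]: "box n a \<in> borel_measurable (Leb {..<n})"
  unfolding box_def by measurable

lemma nn_integral_box: "(\<integral>\<^sup>+v. box n a v \<partial>Leb {..<n}) = 2 ^ n"
  unfolding box_def by (subst lborel_prod.product_nn_integral_prod) auto

lemma nn_integral_interval_overlap:
  fixes a s :: real
  shows "(\<integral>\<^sup>+t. indicator {a - 1..a + 1} t * indicator {a - 1..a + 1} (t + s) \<partial>lborel)
    = ennreal (max 0 (2 - \<bar>s\<bar>))"
proof -
  have "(\<integral>\<^sup>+t. indicator {a - 1..a + 1} t * indicator {a - 1..a + 1} (t + s) \<partial>lborel)
      = (\<integral>\<^sup>+t. indicator {max (a - 1) (a - 1 - s)..min (a + 1) (a + 1 - s)} t \<partial>lborel)"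
    by (intro nn_integral_cong) (auto simp: indicator_def)
  also have "\<dots> = ennreal (max 0 (2 - \<bar>s\<bar>))"
    by (auto simp: emeasure_lborel_Icc_eq max_def min_def abs_if intro!: arg_cong[where f = ennreal])
  finally show ?thesis .
qed

lemma nn_integral_box_overlap:
  "(\<integral>\<^sup>+v. box n a v * box n a (vadd n v w) \<partial>Leb {..<n}) = tent n w"
proof -
  have "(\<integral>\<^sup>+v. box n a v * box n a (vadd n v w) \<partial>Leb {..<n})
      = (\<integral>\<^sup>+v. (\<Prod>i<n. indicator {a i - 1..a i + 1} (v i) * indicator {a i - 1..a i + 1} (v i + w i)) \<partial>Leb {..<n})"
    by (simp add: box_def vadd_def prod.distrib)
  also have "\<dots> = tent n w"
    unfolding tent_def
    by (subst lborel_prod.product_nn_integral_prod) (auto simp: nn_integral_interval_overlap)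
  finally show ?thesis .
qed

lemma tent_sum_ge:
  assumes "mdet n B = 1"
  shows "4 ^ n \<le> (\<integral>\<^sup>+c. tent n (lvec n B c) \<partial>count_space (Zn n))"
  using periodization_second_moment[OF assms, of "box n (\<lambda>_. 0)"]
  by (simp add: nn_integral_box nn_integral_box_overlap power_mult[symmetric] mult.commute[of n] power_mult)

lemma box_nonzero_iff: "box n a v \<noteq> 0 \<longleftrightarrow> (\<forall>i<n. \<bar>v i - a i\<bar> \<le> 1)"
proof -
  have "box n a v \<noteq> 0 \<longleftrightarrow> (\<forall>i<n. v i \<in> {a i - 1..a i + 1})"
    by (auto simp: box_def indicator_def)
  also have "\<dots> \<longleftrightarrow> (\<forall>i<n. \<bar>v i - a i\<bar> \<le> 1)"
    by (intro all_cong) (auto simp: abs_le_iff)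
  finally show ?thesis .
qed

text \<open>The sum of the two boxes has integral \<open>2 * 2 ^ n\<close>. No lattice translate of
  one box meets the other, so the cross terms vanish and the second moment is twice the tent sum.
  Cauchy--Schwarz then gives \<open>4 * 4 ^ n\<close> as a lower bound for twice that sum.\<close>

lemma tent_sum_ge_uncovered:
  assumes det: "mdet n B = 1" and unc: "\<And>c. \<exists>i<n. \<bar>x i - lvec n B c i\<bar> > 2"
  shows "2 * 4 ^ n \<le> (\<integral>\<^sup>+c. tent n (lvec n B c) \<partial>count_space (Zn n))"
proof -
  define \<phi> where "\<phi> = (\<lambda>v. box n (\<lambda>_. 0) v + box n x v)"
  have [measurable]: "\<phi> \<in> borel_measurable (Leb {..<n})" unfolding \<phi>_def by measurable
  have int: "(\<integral>\<^sup>+v. \<phi> v \<partial>Leb {..<n}) = 2 * 2 ^ n"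
    unfolding \<phi>_def by (subst nn_integral_add) (auto simp: nn_integral_box mult_2)
  have overlap: "(\<integral>\<^sup>+v. \<phi> v * \<phi> (vadd n v (lvec n B c)) \<partial>Leb {..<n}) = 2 * tent n (lvec n B c)" for c
  proof -
    let ?w = "lvec n B c"
    have neg: "lvec n B (\<lambda>i. - c i) i = - ?w i" for i
      by (simp add: lvec_def mvec_def sum_negf)
    have "box n (\<lambda>_. 0) v * box n x (vadd n v ?w) = 0" for v
    proof (rule ccontr)
      assume "\<not> ?thesis"
      then have v: "\<forall>i<n. \<bar>v i\<bar> \<le> 1" "\<forall>i<n. \<bar>v i + ?w i - x i\<bar> \<le> 1"
        using box_nonzero_iff[of n "\<lambda>_. 0" v] box_nonzero_iff[of n x "vadd n v ?w"] by (auto simp: vadd_def)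
      obtain i where "i < n" "\<bar>x i - ?w i\<bar> > 2" using unc by blast
      with v show False by (smt (verit))
    qed
    moreover have "box n x v * box n (\<lambda>_. 0) (vadd n v ?w) = 0" for v
    proof (rule ccontr)
      assume "\<not> ?thesis"
      then have v: "\<forall>i<n. \<bar>v i - x i\<bar> \<le> 1" "\<forall>i<n. \<bar>v i + ?w i\<bar> \<le> 1"
        using box_nonzero_iff[of n x v] box_nonzero_iff[of n "\<lambda>_. 0" "vadd n v ?w"] by (auto simp: vadd_def)
      \<comment> \<open>This cross term involves the opposite lattice vector. Since
        \<open>unc\<close> speaks of all coefficient functions, the negated coefficients are
        admissible even if they leave \<open>Zn n\<close>.\<close>
      obtain i where "i < n" "\<bar>x i - (- ?w i)\<bar> > 2" using unc[of "\<lambda>i. - c i"] neg by auto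
      with v show False by (smt (verit))
    qed
    ultimately have "\<phi> v * \<phi> (vadd n v ?w)
        = box n (\<lambda>_. 0) v * box n (\<lambda>_. 0) (vadd n v ?w) + box n x v * box n x (vadd n v ?w)" for v
      by (simp add: \<phi>_def distrib_left distrib_right)
    then have "(\<integral>\<^sup>+v. \<phi> v * \<phi> (vadd n v ?w) \<partial>Leb {..<n})
        = (\<integral>\<^sup>+v. box n (\<lambda>_. 0) v * box n (\<lambda>_. 0) (vadd n v ?w) \<partial>Leb {..<n})
          + (\<integral>\<^sup>+v. box n x v * box n x (vadd n v ?w) \<partial>Leb {..<n})"
      by (simp add: nn_integral_add)
    then show ?thesis by (simp add: nn_integral_box_overlap mult_2)
  qed
  let ?S = "\<integral>\<^sup>+c. tent n (lvec n B c) \<partial>count_space (Zn n)"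
  have "(2 * 2 ^ n)\<^sup>2 \<le> (2 :: ennreal) * ?S"
    using periodization_second_moment[OF det, of \<phi>] by (simp add: int overlap nn_integral_cmult)
  also have "(2 * 2 ^ n)\<^sup>2 = 2 * (2 * 4 ^ n :: ennreal)"
    by (simp add: power2_eq_square power_mult_distrib[symmetric] mult_ac)
  finally show ?thesis
    by (subst (asm) ennreal_mult_le_mult_iff) auto
qed

text \<open>It depends on the lattice as a set of vectors, not on a basis, so it is a function on
  the space that carries the Siegel measure.\<close>

definition lattice_sum :: "((nat \<Rightarrow> real) \<Rightarrow> ennreal) \<Rightarrow> (nat \<Rightarrow> real) set \<Rightarrow> ennreal" where
  "lattice_sum f L = (\<integral>\<^sup>+w. f w \<partial>count_space (L - {\<lambda>_. 0}))"

text \<open>The first form splits off the zero vector. The second sums over the fixed index set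
  \<open>Zn n\<close>, so that measurability in \<open>B\<close> can be checked term by
  term.\<close>

lemma lattice_sum_lat:
  assumes "mdet n B \<noteq> 0"
  shows "(\<integral>\<^sup>+c. f (lvec n B c) \<partial>count_space (Zn n)) = f (\<lambda>_. 0) + lattice_sum f (lat n B)"
    and "lattice_sum f (lat n B) = (\<integral>\<^sup>+c. f (lvec n B c) * indicator {c. lvec n B c \<noteq> (\<lambda>_. 0)} c \<partial>count_space (Zn n))"
proof -
  let ?L = "lat n B" and ?z = "\<lambda>_::nat. 0::real"
  have bij: "bij_betw (lvec n B) (Zn n) ?L"
    using lvec_inj[OF assms] by (simp add: bij_betw_def lat_eq)
  have z: "?z \<in> ?L" by (auto simp: lat_def mvec_def intro!: exI[of _ "\<lambda>_. 0"])
  have L: "lattice_sum f ?L = (\<integral>\<^sup>+w. f w * indicator (- {?z}) w \<partial>count_space ?L)"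
    unfolding lattice_sum_def
    by (subst nn_integral_count_space_eq[of _ ?L, symmetric])
       (auto simp: nn_integral_count_space_indicator indicator_def intro!: nn_integral_cong)
  have "(\<integral>\<^sup>+c. f (lvec n B c) \<partial>count_space (Zn n)) = (\<integral>\<^sup>+w. f w \<partial>count_space ?L)"
    by (rule nn_integral_bij_count_space[OF bij])
  also have "\<dots> = (\<integral>\<^sup>+w. f w * indicator {?z} w + f w * indicator (- {?z}) w \<partial>count_space ?L)"
    by (intro nn_integral_cong) (auto simp: indicator_def)
  also have "\<dots> = (\<integral>\<^sup>+w. f w * indicator {?z} w \<partial>count_space ?L) + lattice_sum f ?L"
    unfolding L by (rule nn_integral_add) auto
  also have "(\<integral>\<^sup>+w. f w * indicator {?z} w \<partial>count_space ?L) = (\<Sum>w\<in>{?z}. f w * indicator {?z} w)"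
    using z by (intro nn_integral_count_space') auto
  finally show "(\<integral>\<^sup>+c. f (lvec n B c) \<partial>count_space (Zn n)) = f ?z + lattice_sum f ?L" by simp
  show "lattice_sum f ?L = (\<integral>\<^sup>+c. f (lvec n B c) * indicator {c. lvec n B c \<noteq> ?z} c \<partial>count_space (Zn n))"
    unfolding L by (subst nn_integral_bij_count_space[OF bij, symmetric])
      (auto simp: indicator_def intro!: nn_integral_cong)
qed

lemma tent_zero: "tent n (\<lambda>_. 0) = 2 ^ n"
  by (simp add: tent_def)

lemma lattice_sum_tent_ge:
  assumes "B \<in> SLn n"
  shows "4 ^ n \<le> 2 ^ n + lattice_sum (tent n) (lat n B)"
  using tent_sum_ge[of n B] lattice_sum_lat(1)[of n B "tent n"] assms by (simp add: SLn_def tent_zero)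

lemma covering_radius_le:
  assumes "\<And>x. x \<in> rvecs n \<Longrightarrow> \<exists>w\<in>L. \<forall>i<n. \<bar>x i - w i\<bar> \<le> 2"
  shows "covering_radius n L \<le> 2 * sqrt (real n)"
  unfolding covering_radius_def
proof (rule cSUP_least)
  show "rvecs n \<noteq> {}" by (auto simp: rvecs_def)
next
  fix x assume "x \<in> rvecs n"
  then obtain w where w: "w \<in> L" "\<forall>i<n. \<bar>x i - w i\<bar> \<le> 2" using assms by blast
  have "(INF v\<in>L. vnorm n (x - v)) \<le> vnorm n (x - w)"
    by (rule cINF_lower[OF bdd_belowI[of _ 0]]) (auto simp: vnorm_def sum_nonneg w)
  also have "(\<Sum>i<n. ((x - w) i)\<^sup>2) \<le> (\<Sum>i<n. 2\<^sup>2)"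
  proof (rule sum_mono)
    fix i assume "i \<in> {..<n}"
    then have "\<bar>(x - w) i\<bar> \<le> \<bar>2\<bar>" using w by simp
    then show "((x - w) i)\<^sup>2 \<le> 2\<^sup>2" by (rule abs_le_square_iff[THEN iffD1])
  qed
  then have "vnorm n (x - w) \<le> sqrt (4 * real n)"
    unfolding vnorm_def by (simp add: mult.commute)
  also have "\<dots> = 2 * sqrt (real n)" by (simp add: real_sqrt_mult)
  finally show "(INF v\<in>L. vnorm n (x - v)) \<le> 2 * sqrt (real n)" .
qed

text \<open>The event of the theorem is a strict inequality, while covering by cubes yields only
  \<open>\<le>\<close>; the constant 3 in place of 2 absorbs the difference.\<close>

lemma lattice_sum_tent_ge_covering:
  assumes B: "B \<in> SLn n" and "n > 0" and cov: "\<not> covering_radius n (lat n B) < 3 * sqrt (real n)"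
  shows "2 * 4 ^ n \<le> 2 ^ n + lattice_sum (tent n) (lat n B)"
proof -
  have "2 * sqrt (real n) < 3 * sqrt (real n)" using \<open>n > 0\<close> by simp
  then have "\<not> covering_radius n (lat n B) \<le> 2 * sqrt (real n)" using cov by linarith
  then obtain x where x: "\<And>w. w \<in> lat n B \<Longrightarrow> \<exists>i<n. \<bar>x i - w i\<bar> > 2"
    using covering_radius_le[of n "lat n B"] by (meson not_le)
  have "\<exists>i<n. \<bar>x i - lvec n B c i\<bar> > 2" for c
    by (rule x) (auto simp: lat_def lvec_def)
  then show ?thesis
    using tent_sum_ge_uncovered[of n B x] lattice_sum_lat(1)[of n B "tent n"] B by (simp add: SLn_def tent_zero)
qed

section \<open>Measurability on the space of lattices\<close>

lemma measurable_entry: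
  "i < n \<Longrightarrow> j < n \<Longrightarrow> (\<lambda>B. B (i, j)) \<in> borel_measurable (mat_space n)"
  unfolding mat_space_def using measurable_component_singleton[of "(i, j)" "{..<n} \<times> {..<n}" "\<lambda>_. lborel"] by simp

lemma measurable_mdet [measurable]: "mdet n \<in> borel_measurable (mat_space n)"
proof -
  have "(\<lambda>B. \<Prod>i<n. B (i, p i)) \<in> borel_measurable (mat_space n)" if "p permutes {..<n}" for p
    using permutes_in_image[OF that] by (intro borel_measurable_prod measurable_entry) auto
  then show ?thesis unfolding mdet_def by (intro borel_measurable_sum borel_measurable_times) auto
qed

lemma SLn_sets [measurable]: "SLn n \<in> sets (mat_space n)"
  unfolding SLn_def by measurable

lemma measurable_lvec [measurable]: "(\<lambda>B. lvec n B c i) \<in> borel_measurable (mat_space n)"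
  unfolding lvec_def mvec_def by (cases "i < n") (auto intro!: borel_measurable_sum borel_measurable_times measurable_entry)

lemma measurable_mmul [measurable]: "mmul n A \<in> measurable (mat_space n) (mat_space n)"
proof -
  have "(\<lambda>B. \<Sum>k<n. A (fst p, k) * B (k, snd p)) \<in> measurable (mat_space n) lborel" if "p \<in> {..<n} \<times> {..<n}" for p
    using that by (auto intro!: borel_measurable_sum borel_measurable_times measurable_entry)
  then show ?thesis
    unfolding mmul_def by (subst (2) mat_space_def) (intro measurable_restrict)
qed

text \<open>The sigma-algebra on lattices is the quotient one, so measurability can be tested after
  pulling back to \<open>SLn n\<close>.\<close>

lemma measurable_lattice_function:
  assumes \<nu>: "siegel_measure n \<nu>" and [measurable]: "G \<in> borel_measurable (mat_space n)"
    and eq: "\<And>B. B \<in> SLn n \<Longrightarrow> F (lat n B) = G B"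
  shows "F \<in> borel_measurable \<nu>"
proof (rule measurableI)
  fix S :: "'a set" assume [measurable]: "S \<in> sets borel"
  have "lat n -` (F -` S \<inter> space \<nu>) \<inter> SLn n = (G -` S \<inter> space (mat_space n)) \<inter> SLn n"
    using \<nu> eq by (auto simp: siegel_measure_def unimod_lattices_def SLn_def)
  also have "\<dots> \<in> sets (mat_space n)" by measurable
  finally show "F -` S \<inter> space \<nu> \<in> sets \<nu>"
    using \<nu> by (auto simp: siegel_measure_def lattice_sets_def)
qed simp

lemma measurable_lattice_sum:
  assumes \<nu>: "siegel_measure n \<nu>"
    and f: "\<And>c. (\<lambda>B. f (lvec n B c)) \<in> borel_measurable (mat_space n)"
  shows "lattice_sum f \<in> borel_measurable \<nu>"
proof (rule measurable_lattice_function[OF \<nu>])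
  show "(\<lambda>B. \<integral>\<^sup>+c. f (lvec n B c) * indicator {c. lvec n B c \<noteq> (\<lambda>_. 0)} c \<partial>count_space (Zn n))
      \<in> borel_measurable (mat_space n)"
  proof (rule borel_measurable_nn_integral_count_space)
    fix c
    \<comment> \<open>Being nonzero is a finite disjunction over coordinates, hence a measurable
      condition on \<open>B\<close>.\<close>
    have "(lvec n B c \<noteq> (\<lambda>_. 0)) \<longleftrightarrow> (\<exists>i\<in>{..<n}. lvec n B c i \<noteq> 0)" for B
      by (auto simp: fun_eq_iff lvec_def mvec_def)
    then have "(\<lambda>B. indicator {c. lvec n B c \<noteq> (\<lambda>_. 0)} c :: ennreal)
        = indicator {B. \<exists>i\<in>{..<n}. lvec n B c i \<noteq> 0}"
      by (auto simp: indicator_def fun_eq_iff)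
    moreover have "(indicator {B. \<exists>i\<in>{..<n}. lvec n B c i \<noteq> 0} :: _ \<Rightarrow> ennreal) \<in> borel_measurable (mat_space n)"
      by measurable
    ultimately have "(\<lambda>B. indicator {c. lvec n B c \<noteq> (\<lambda>_. 0)} c :: ennreal) \<in> borel_measurable (mat_space n)"
      by (simp only:)
    then show "(\<lambda>B. f (lvec n B c) * indicator {c. lvec n B c \<noteq> (\<lambda>_. 0)} c) \<in> borel_measurable (mat_space n)"
      by (rule borel_measurable_times_ennreal[OF f])
  qed simp
qed (auto simp: SLn_def intro!: lattice_sum_lat(2))

lemma image_mvec_lat: "mvec n g ` lat n B = lat n (mmul n g B)"
  by (auto simp: lat_def mvec_mmul)

lemma SLn_space: "B \<in> SLn n \<Longrightarrow> B \<in> space (mat_space n)"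
  by (simp add: SLn_def)

text \<open>Invariance is assumed for images of sets, whereas \<open>distr\<close> works with
  preimages. The preimage under \<open>g\<close> is the image under the inverse of \<open>g\<close>,
  so the image measure is \<open>\<nu>\<close> itself.\<close>

lemma siegel_invariant:
  assumes \<nu>: "siegel_measure n \<nu>" and g: "g \<in> SLn n" and F: "F \<in> borel_measurable \<nu>"
  shows "(\<lambda>L. F (mvec n g ` L)) \<in> borel_measurable \<nu>"
    and "(\<integral>\<^sup>+L. F (mvec n g ` L) \<partial>\<nu>) = (\<integral>\<^sup>+L. F L \<partial>\<nu>)"
proof -
  let ?T = "\<lambda>g L. mvec n g ` L"
  have sp: "space \<nu> = lat n ` SLn n" and se: "sets \<nu> = lattice_sets n"
    using \<nu> by (auto simp: siegel_measure_def unimod_lattices_def)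
  have into: "?T h L \<in> space \<nu>" if "h \<in> SLn n" "L \<in> space \<nu>" for h L
    using that by (auto simp: sp image_mvec_lat mmul_SLn)
  have T: "?T g \<in> measurable \<nu> \<nu>"
  proof (rule measurableI)
    fix A assume A: "A \<in> sets \<nu>"
    have "lat n -` (?T g -` A \<inter> space \<nu>) \<inter> SLn n
        = (mmul n g -` (lat n -` A \<inter> SLn n) \<inter> space (mat_space n)) \<inter> SLn n"
      using SLn_space g by (auto simp: image_mvec_lat sp mmul_SLn)
    also have "\<dots> \<in> sets (mat_space n)"
    proof -
      have "lat n -` A \<inter> SLn n \<in> sets (mat_space n)" using A by (simp add: se lattice_sets_def)
      from measurable_sets[OF measurable_mmul this] SLn_sets show ?thesis by (rule sets.Int)
    qed
    finally show "?T g -` A \<inter> space \<nu> \<in> sets \<nu>"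
      by (auto simp: se lattice_sets_def sp unimod_lattices_def)
  qed (use into g in auto)
  obtain g' where g': "g' \<in> SLn n"
    "\<And>x. x \<in> rvecs n \<Longrightarrow> mvec n g (mvec n g' x) = x" "\<And>x. x \<in> rvecs n \<Longrightarrow> mvec n g' (mvec n g x) = x"
    using SLn_inverse[OF g] by metis
  have rv: "x \<in> rvecs n" if "L \<in> space \<nu>" "x \<in> L" for x L
    using that by (auto simp: sp lat_def)
  have inv: "?T g (?T g' L) = L" "?T g' (?T g L) = L" if "L \<in> space \<nu>" for L
    using rv[OF that] g' by (force simp: image_image)+
  have "distr \<nu> \<nu> (?T g) = \<nu>"
  proof (rule measure_eqI)
    fix A assume "A \<in> sets (distr \<nu> \<nu> (?T g))"
    then have A: "A \<in> sets \<nu>" by simp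
    have "?T g -` A \<inter> space \<nu> = ?T g' ` A"
    proof (intro equalityI subsetI)
      fix L assume "L \<in> ?T g -` A \<inter> space \<nu>"
      then show "L \<in> ?T g' ` A" using inv(2)[of L] by (intro image_eqI[of _ _ "?T g L"]) auto
    next
      fix L assume "L \<in> ?T g' ` A"
      then obtain M where M: "M \<in> A" "L = ?T g' M" by auto
      then have "M \<in> space \<nu>" using sets.sets_into_space[OF A] by auto
      then show "L \<in> ?T g -` A \<inter> space \<nu>" using M inv(1)[of M] into[OF g'(1), of M] by simp
    qed
    moreover have "emeasure \<nu> (?T g' ` A) = emeasure \<nu> A"
      using \<nu> g'(1) A unfolding siegel_measure_def by blast
    ultimately show "emeasure (distr \<nu> \<nu> (?T g)) A = emeasure \<nu> A"
      using T A by (simp add: emeasure_distr)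
  qed simp
  then show "(\<integral>\<^sup>+L. F (?T g L) \<partial>\<nu>) = (\<integral>\<^sup>+L. F L \<partial>\<nu>)"
    using nn_integral_distr[OF T, of F] F by simp
  show "(\<lambda>L. F (?T g L)) \<in> borel_measurable \<nu>"
    using measurable_compose[OF T F] .
qed

section \<open>Measurability of the covering radius\<close>

lemma vnorm_eq_L2_set: "vnorm n x = L2_set x {..<n}"
  by (simp add: vnorm_def L2_set_def)

definition lat_dist :: "nat \<Rightarrow> (nat \<Rightarrow> real) set \<Rightarrow> (nat \<Rightarrow> real) \<Rightarrow> real" where
  "lat_dist n L x = (INF v\<in>L. vnorm n (x - v))"

lemma lat_nonempty: "lat n B \<noteq> {}"
  by (auto simp: lat_def)

lemma lat_dist_le: "v \<in> L \<Longrightarrow> lat_dist n L x \<le> vnorm n (x - v)"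
  unfolding lat_dist_def by (rule cINF_lower[OF bdd_belowI[of _ 0]]) (auto simp: vnorm_def sum_nonneg)

lemma lat_dist_Lipschitz:
  assumes "L \<noteq> {}"
  shows "lat_dist n L x \<le> lat_dist n L y + vnorm n (x - y)"
proof -
  have "lat_dist n L x - vnorm n (x - y) \<le> lat_dist n L y"
    unfolding lat_dist_def[of n L y]
  proof (rule cINF_greatest[OF assms])
    fix v assume v: "v \<in> L"
    have "vnorm n (x - v) = L2_set (\<lambda>i. (x - y) i + (y - v) i) {..<n}"
      by (simp add: vnorm_eq_L2_set L2_set_def)
    also have "\<dots> \<le> vnorm n (x - y) + vnorm n (y - v)"
      unfolding vnorm_eq_L2_set by (rule L2_set_triangle_ineq)
    finally show "lat_dist n L x - vnorm n (x - y) \<le> vnorm n (y - v)"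
      using lat_dist_le[OF v, of n x] by linarith
  qed
  then show ?thesis by simp
qed

text \<open>Rounding down the coordinates in the basis leaves an error in the fundamental
  parallelepiped, bounded by the entries of \<open>B\<close>. Without such a bound the real supremum
  in \<open>covering_radius\<close> would carry no information.\<close>

lemma lat_dist_bounded:
  assumes B: "B \<in> SLn n"
  shows "bdd_above (lat_dist n (lat n B) ` rvecs n)"
proof (rule bdd_aboveI2)
  fix x assume x: "x \<in> rvecs n"
  obtain B' where B': "mvec n B (mvec n B' x) = x" using SLn_inverse[OF B] x by metis
  define y where "y = mvec n B' x"
  have "mvec n B (\<lambda>j. real_of_int \<lfloor>y j\<rfloor>) \<in> lat n B" by (auto simp: lat_def)
  from lat_dist_le[OF this, of n x]
  have "lat_dist n (lat n B) x \<le> vnorm n (x - mvec n B (\<lambda>j. real_of_int \<lfloor>y j\<rfloor>))" .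
  also have "\<dots> \<le> (\<Sum>i<n. \<bar>(x - mvec n B (\<lambda>j. real_of_int \<lfloor>y j\<rfloor>)) i\<bar>)"
    unfolding vnorm_eq_L2_set by (rule L2_set_le_sum_abs)
  also have "\<dots> \<le> (\<Sum>i<n. \<Sum>j<n. \<bar>B (i, j)\<bar>)"
  proof (rule sum_mono)
    fix i assume i: "i \<in> {..<n}"
    have "x i = (\<Sum>j<n. B (i, j) * y j)"
      using fun_cong[OF B', of i] i by (simp add: y_def[symmetric]) (simp add: mvec_def)
    then have "(x - mvec n B (\<lambda>j. real_of_int \<lfloor>y j\<rfloor>)) i = (\<Sum>j<n. B (i, j) * frac (y j))"
      using i by (simp add: mvec_def frac_def algebra_simps sum_subtractf)
    also have "\<bar>\<dots>\<bar> \<le> (\<Sum>j<n. \<bar>B (i, j) * frac (y j)\<bar>)" by (rule sum_abs)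
    also have "\<dots> \<le> (\<Sum>j<n. \<bar>B (i, j)\<bar>)"
      by (intro sum_mono) (auto simp: abs_mult frac_lt_1 less_imp_le intro!: mult_left_le)
    finally show "\<bar>(x - mvec n B (\<lambda>j. real_of_int \<lfloor>y j\<rfloor>)) i\<bar> \<le> (\<Sum>j<n. \<bar>B (i, j)\<bar>)" .
  qed
  finally show "lat_dist n (lat n B) x \<le> (\<Sum>i<n. \<Sum>j<n. \<bar>B (i, j)\<bar>)" .
qed

definition qvec :: "nat \<Rightarrow> (nat \<Rightarrow> rat) \<Rightarrow> nat \<Rightarrow> real" where
  "qvec n q = (\<lambda>i. if i < n then of_rat (q i) else 0)"

text \<open>This replaces a supremum over all points by countably many conditions. Rational points
  suffice because the distance to the lattice is Lipschitz, and the margin \<open>1 / Suc k\<close>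
  keeps the inequality strict for the supremum.\<close>

lemma covering_radius_less_iff:
  assumes B: "B \<in> SLn n"
  shows "covering_radius n (lat n B) < r \<longleftrightarrow>
    (\<exists>k::nat. \<forall>q \<in> PiE {..<n} (\<lambda>_. UNIV). lat_dist n (lat n B) (qvec n q) \<le> r - 1 / Suc k)"
proof -
  let ?D = "lat_dist n (lat n B)" and ?Q = "PiE {..<n} (\<lambda>_. UNIV :: rat set)"
  have cov: "covering_radius n (lat n B) = (SUP x\<in>rvecs n. ?D x)"
    by (simp add: covering_radius_def lat_dist_def)
  show ?thesis
  proof
    assume "covering_radius n (lat n B) < r"
    then obtain k where k: "1 / Suc k < r - covering_radius n (lat n B)"
      using nat_approx_posE[of "r - covering_radius n (lat n B)"] by auto
    have "?D (qvec n q) \<le> r - 1 / Suc k" for q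
    proof -
      have "?D (qvec n q) \<le> covering_radius n (lat n B)"
        unfolding cov by (rule cSUP_upper[OF _ lat_dist_bounded[OF B]]) (auto simp: qvec_def rvecs_def)
      then show ?thesis using k by linarith
    qed
    then show "\<exists>k::nat. \<forall>q \<in> ?Q. ?D (qvec n q) \<le> r - 1 / Suc k" by blast
  next
    assume "\<exists>k::nat. \<forall>q \<in> ?Q. ?D (qvec n q) \<le> r - 1 / Suc k"
    then obtain k :: nat where k: "\<And>q. q \<in> ?Q \<Longrightarrow> ?D (qvec n q) \<le> r - 1 / Suc k" by blast
    have "?D x \<le> r - 1 / Suc k" for x
    proof (rule field_le_epsilon)
      fix e :: real assume "e > 0"
      \<comment> \<open>The \<open>n\<close> coordinate errors of size \<open>\<delta>\<close> add
        up to at most \<open>e\<close>; the added 1 keeps the divisor positive for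
        \<open>n = 0\<close>.\<close>
      define \<delta> where "\<delta> = e / (real n + 1)"
      have "\<delta> > 0" using \<open>e > 0\<close> by (simp add: \<delta>_def)
      have "\<exists>t::rat. \<bar>x i - of_rat t\<bar> \<le> \<delta>" for i
      proof -
        obtain t :: rat where "x i < of_rat t" "of_rat t < x i + \<delta>"
          using of_rat_dense[of "x i" "x i + \<delta>"] \<open>\<delta> > 0\<close> by auto
        then show ?thesis by (intro exI[of _ t]) (simp add: abs_le_iff)
      qed
      then obtain t :: "nat \<Rightarrow> rat" where t: "\<And>i. \<bar>x i - of_rat (t i)\<bar> \<le> \<delta>" by metis
      define q where "q = restrict t {..<n}"
      have "vnorm n (x - qvec n q) \<le> (\<Sum>i<n. \<bar>(x - qvec n q) i\<bar>)"
        unfolding vnorm_eq_L2_set by (rule L2_set_le_sum_abs)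
      also have "\<dots> \<le> (\<Sum>i<n. \<delta>)" using t by (intro sum_mono) (auto simp: qvec_def q_def)
      also have "\<dots> \<le> e" using \<open>e > 0\<close> by (simp add: \<delta>_def field_simps)
      finally have "vnorm n (x - qvec n q) \<le> e" .
      moreover have "?D (qvec n q) \<le> r - 1 / Suc k" by (rule k) (auto simp: q_def)
      ultimately show "?D x \<le> r - 1 / Suc k + e"
        using lat_dist_Lipschitz[OF lat_nonempty, of n n B x "qvec n q"] by linarith
    qed
    then have "covering_radius n (lat n B) \<le> r - 1 / Suc k"
      unfolding cov by (intro cSUP_least) (auto simp: rvecs_def)
    also have "\<dots> < r" by simp
    finally show "covering_radius n (lat n B) < r" .
  qed
qed

lemma covering_radius_event:
  assumes \<nu>: "siegel_measure n \<nu>"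
  shows "{L \<in> unimod_lattices n. covering_radius n L < r} \<in> sets \<nu>"
proof -
  have D [measurable]: "(\<lambda>B. lat_dist n (lat n B) x) \<in> borel_measurable (mat_space n)" for x
  proof -
    have "lat_dist n (lat n B) x = (INF c\<in>Zn n. vnorm n (x - lvec n B c))" for B
      by (simp add: lat_dist_def lat_eq image_image)
    moreover have "(\<lambda>B. INF c\<in>Zn n. vnorm n (x - lvec n B c)) \<in> borel_measurable (mat_space n)"
      by (rule borel_measurable_cINF)
         (auto simp: vnorm_def sum_nonneg intro!: bdd_belowI[of _ 0] exI[of _ "\<lambda>_\<in>{..<n}. 0"])
    ultimately show ?thesis by simp
  qed
  have [measurable]: "countable (PiE {..<n} (\<lambda>_. UNIV :: rat set))" by (intro countable_PiE) auto
  have "lat n -` {L \<in> unimod_lattices n. covering_radius n L < r} \<inter> SLn n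
     = {B \<in> space (mat_space n). \<exists>k::nat. \<forall>q \<in> PiE {..<n} (\<lambda>_. UNIV :: rat set). lat_dist n (lat n B) (qvec n q) \<le> r - 1 / Suc k} \<inter> SLn n"
    using covering_radius_less_iff[of _ n r] by (auto simp: unimod_lattices_def SLn_def)
  also have "\<dots> \<in> sets (mat_space n)" by measurable
  finally show ?thesis using \<nu> by (auto simp: siegel_measure_def lattice_sets_def)
qed

section \<open>Averaging over expanding horospheres\<close>

definition hat :: "real \<Rightarrow> real" where
  "hat t = max 0 (2 - \<bar>t\<bar>)"

lemma hat_nonneg [simp]: "0 \<le> hat t" and hat_le: "hat t \<le> 2" and hat_zero: "2 \<le> \<bar>t\<bar> \<Longrightarrow> hat t = 0"
  by (auto simp: hat_def)

lemma tent_eq: "tent n w = ennreal (\<Prod>i<n. hat (w i))"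
  unfolding tent_def hat_def by (rule prod_ennreal) simp

text \<open>A unipotent matrix that adds \<open>x i * w 0\<close> to each coordinate
  \<open>i > 0\<close>, followed by a diagonal matrix that contracts coordinate 0 and expands the
  others by \<open>T\<close>. As \<open>x\<close> varies, its images of a lattice trace an expanding
  horosphere.\<close>

definition horo :: "nat \<Rightarrow> nat \<Rightarrow> (nat \<Rightarrow> real) \<Rightarrow> nat \<times> nat \<Rightarrow> real" where
  "horo n T x = (\<lambda>(i, j)\<in>{..<n} \<times> {..<n}.
     if j = i then (if i = 0 then 1 / real T ^ (n - 1) else real T) else if j = 0 then real T * x i else 0)"

lemma horo_SLn:
  assumes "n > 0" "T > 0"
  shows "horo n T x \<in> SLn n"
proof -
  have "mdet n (horo n T x) = (\<Prod>i<n. horo n T x (i, i))"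
    using assms by (intro mdet_arrow[of 0]) (auto simp: horo_def)
  also have "{..<n} = insert 0 {1..<n}" using assms by auto
  also have "(\<Prod>i\<in>insert 0 {1..<n}. horo n T x (i, i)) = 1 / real T ^ (n - 1) * (\<Prod>i\<in>{1..<n}. real T)"
    using assms by (subst prod.insert) (auto simp: horo_def intro!: prod.cong)
  also have "\<dots> = 1" using assms by simp
  finally have "mdet n (horo n T x) = 1" .
  moreover have "horo n T x \<in> space (mat_space n)" by (simp add: mat_space_def space_PiM horo_def)
  ultimately show ?thesis by (simp add: SLn_def)
qed

lemma mvec_horo:
  assumes "i < n"
  shows "mvec n (horo n T x) w i = (if i = 0 then w 0 / real T ^ (n - 1) else real T * (w i + x i * w 0))"
proof -
  have "(\<Sum>j<n. horo n T x (i, j) * w j) = (\<Sum>j\<in>{0, i}. horo n T x (i, j) * w j)"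
    using assms by (intro sum.mono_neutral_right) (auto simp: horo_def)
  then show ?thesis using assms by (cases "i = 0") (auto simp: mvec_def horo_def algebra_simps)
qed

text \<open>A Riemann sum, over \<open>x\<close> in [0,1], for the integral of
  \<open>hat (T * (a + x * b))\<close>.\<close>

definition hat_avg :: "nat \<Rightarrow> nat \<Rightarrow> real \<Rightarrow> real \<Rightarrow> real" where
  "hat_avg T M a b = (\<Sum>k<M. hat (real T * (a + real k / real M * b))) / real M"

text \<open>The average of \<open>tent n (mvec n (horo n T x) w)\<close> over the grid of all \<open>x\<close> with coordinates in
  \<open>{k / M | k < M}\<close> factorizes over the coordinates. The mesh \<open>M = T ^ (n + 1)\<close> is fine enough for each
  factor to behave like the integral over \<open>x \<in> [0,1]\<close>.\<close>

definition tent_avg :: "nat \<Rightarrow> nat \<Rightarrow> (nat \<Rightarrow> real) \<Rightarrow> real" where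
  "tent_avg n T w = hat (w 0 / real T ^ (n - 1)) * (\<Prod>i\<in>{1..<n}. hat_avg T (T ^ (n + 1)) (w i) (w 0))"

lemma hat_avg_nonneg [simp]: "0 \<le> hat_avg T M a b"
  by (simp add: hat_avg_def sum_nonneg)

lemma tent_avg_nonneg [simp]: "0 \<le> tent_avg n T w"
  by (simp add: tent_avg_def prod_nonneg)

definition grid :: "nat \<Rightarrow> nat \<Rightarrow> (nat \<Rightarrow> nat) set" where
  "grid n M = PiE {1..<n} (\<lambda>_. {..<M})"

lemma finite_grid [simp]: "finite (grid n M)" and card_grid: "card (grid n M) = M ^ (n - 1)"
  by (auto simp: grid_def card_PiE intro!: finite_PiE)

lemma sum_tent_horo:
  assumes "n > 0" "T > 0" and M: "M = T ^ (n + 1)"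
  shows "(\<Sum>k\<in>grid n M. tent n (mvec n (horo n T (\<lambda>i. real (k i) / real M)) w))
    = ennreal (real (card (grid n M))) * ennreal (tent_avg n T w)"
proof -
  have "M > 0" using assms by simp
  have split: "{..<n} = insert 0 {1..<n}" using assms by auto
  have "(\<Prod>i<n. hat (mvec n (horo n T (\<lambda>i. real (k i) / real M)) w i))
      = hat (w 0 / real T ^ (n - 1)) * (\<Prod>i\<in>{1..<n}. hat (real T * (w i + real (k i) / real M * w 0)))" for k
    using assms unfolding split
    by (subst prod.insert) (auto simp: mvec_horo intro!: prod.cong)
  then have "(\<Sum>k\<in>grid n M. \<Prod>i<n. hat (mvec n (horo n T (\<lambda>i. real (k i) / real M)) w i))
      = hat (w 0 / real T ^ (n - 1)) * (\<Sum>k\<in>grid n M. \<Prod>i\<in>{1..<n}. hat (real T * (w i + real (k i) / real M * w 0)))"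
    by (simp add: sum_distrib_left)
  also have "(\<Sum>k\<in>grid n M. \<Prod>i\<in>{1..<n}. hat (real T * (w i + real (k i) / real M * w 0)))
      = (\<Prod>i\<in>{1..<n}. \<Sum>j<M. hat (real T * (w i + real j / real M * w 0)))"
    unfolding grid_def by (rule prod_sum_PiE[symmetric]) auto
  also have "\<dots> = (\<Prod>i\<in>{1..<n}. real M * hat_avg T M (w i) (w 0))"
    using \<open>M > 0\<close> by (simp add: hat_avg_def)
  also have "\<dots> = real M ^ (n - 1) * (\<Prod>i\<in>{1..<n}. hat_avg T M (w i) (w 0))"
    by (simp add: prod.distrib)
  finally have "(\<Sum>k\<in>grid n M. \<Prod>i<n. hat (mvec n (horo n T (\<lambda>i. real (k i) / real M)) w i))
      = real (card (grid n M)) * tent_avg n T w"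
    by (simp add: tent_avg_def card_grid M)
  then show ?thesis
    by (simp add: tent_eq prod_nonneg sum_ennreal ennreal_mult'[symmetric])
qed

lemma lattice_sum_image:
  assumes g: "g \<in> SLn n" and L: "L \<subseteq> rvecs n"
  shows "lattice_sum f (mvec n g ` L) = lattice_sum (\<lambda>w. f (mvec n g w)) L"
proof -
  obtain g' where g': "\<And>x. x \<in> rvecs n \<Longrightarrow> mvec n g' (mvec n g x) = x"
    using SLn_inverse[OF g] by metis
  have z: "mvec n h (\<lambda>_. 0) = (\<lambda>_. 0)" for h by (simp add: mvec_def fun_eq_iff)
  have "bij_betw (mvec n g) (L - {\<lambda>_. 0}) (mvec n g ` L - {\<lambda>_. 0})"
    unfolding bij_betw_def
  proof
    show "inj_on (mvec n g) (L - {\<lambda>_. 0})" using g' L by (intro inj_on_inverseI[of _ "mvec n g'"]) auto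
    show "mvec n g ` (L - {\<lambda>_. 0}) = mvec n g ` L - {\<lambda>_. 0}"
      using g' L z by (auto simp: image_iff) (metis subsetD)+
  qed
  then show ?thesis
    unfolding lattice_sum_def by (rule nn_integral_bij_count_space[symmetric])
qed

lemma lat_subset_rvecs: "lat n B \<subseteq> rvecs n"
  by (auto simp: lat_def)

lemma measurable_tent_lvec: "(\<lambda>B. tent n (lvec n B c)) \<in> borel_measurable (mat_space n)"
  unfolding tent_def by measurable

lemma measurable_hat [measurable]: "hat \<in> borel_measurable borel"
  unfolding hat_def by measurable

text \<open>By invariance, moving the lattice by any grid point leaves the truncated integral
  unchanged, so the integral equals its average over the grid. Truncation is concave: an average of
  minima with \<open>C\<close> is at most the minimum of the average with \<open>C\<close>.\<close>

lemma siegel_horosphere_average: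
  assumes \<nu>: "siegel_measure n \<nu>" and n: "n > 0" and T: "T > 0"
  shows "lattice_sum (\<lambda>w. ennreal (tent_avg n T w)) \<in> borel_measurable \<nu>"
    and "(\<integral>\<^sup>+L. min (lattice_sum (tent n) L) C \<partial>\<nu>)
      \<le> (\<integral>\<^sup>+L. min (lattice_sum (\<lambda>w. ennreal (tent_avg n T w)) L) C \<partial>\<nu>)"
proof -
  let ?F = "lattice_sum (tent n)" and ?A = "lattice_sum (\<lambda>w. ennreal (tent_avg n T w))"
  show A [measurable]: "?A \<in> borel_measurable \<nu>"
    by (rule measurable_lattice_sum[OF \<nu>]) (simp add: tent_avg_def hat_avg_def)
  define M where "M = T ^ (n + 1)"
  define g where "g = (\<lambda>k. horo n T (\<lambda>i. real (k i) / real M))"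
  let ?X = "grid n M" and ?N = "ennreal (real (card (grid n M)))"
  have N: "?N \<noteq> 0" "?N \<noteq> \<top>" using T by (auto simp: M_def card_grid)
  have g: "g k \<in> SLn n" for k using horo_SLn[OF n T] by (simp add: g_def)
  have F [measurable]: "?F \<in> borel_measurable \<nu>"
    by (rule measurable_lattice_sum[OF \<nu> measurable_tent_lvec])
  have Fg [measurable]: "(\<lambda>L. ?F (mvec n (g k) ` L)) \<in> borel_measurable \<nu>" for k
    by (rule siegel_invariant(1)[OF \<nu> g F])
  have sum: "(\<Sum>k\<in>?X. ?F (mvec n (g k) ` L)) = ?N * ?A L" if L: "L \<in> space \<nu>" for L
  proof -
    have "L \<subseteq> rvecs n" using L \<nu> lat_subset_rvecs by (auto simp: siegel_measure_def unimod_lattices_def)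
    then have "(\<Sum>k\<in>?X. ?F (mvec n (g k) ` L)) = (\<Sum>k\<in>?X. lattice_sum (\<lambda>w. tent n (mvec n (g k) w)) L)"
      by (intro sum.cong lattice_sum_image g) auto
    also have "\<dots> = lattice_sum (\<lambda>w. \<Sum>k\<in>?X. tent n (mvec n (g k) w)) L"
      unfolding lattice_sum_def by (rule nn_integral_sum[symmetric]) simp
    also have "\<dots> = lattice_sum (\<lambda>w. ?N * ennreal (tent_avg n T w)) L"
      unfolding g_def by (simp add: sum_tent_horo[OF n T M_def])
    finally show ?thesis unfolding lattice_sum_def by (simp add: nn_integral_cmult)
  qed
  have "?N * (\<integral>\<^sup>+L. min (?F L) C \<partial>\<nu>) = (\<Sum>k\<in>?X. \<integral>\<^sup>+L. min (?F (mvec n (g k) ` L)) C \<partial>\<nu>)"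
    using siegel_invariant(2)[OF \<nu> g, of "\<lambda>L. min (?F L) C"] by (simp add: ennreal_of_nat_eq_real_of_nat)
  also have "\<dots> = (\<integral>\<^sup>+L. (\<Sum>k\<in>?X. min (?F (mvec n (g k) ` L)) C) \<partial>\<nu>)"
    by (rule nn_integral_sum[symmetric]) simp
  also have "\<dots> \<le> (\<integral>\<^sup>+L. ?N * min (?A L) C \<partial>\<nu>)"
  proof (rule nn_integral_mono)
    fix L assume L: "L \<in> space \<nu>"
    have "(\<Sum>k\<in>?X. min (?F (mvec n (g k) ` L)) C) \<le> (\<Sum>k\<in>?X. ?F (mvec n (g k) ` L))"
      by (intro sum_mono) simp
    moreover have "(\<Sum>k\<in>?X. min (?F (mvec n (g k) ` L)) C) \<le> (\<Sum>k\<in>?X. C)"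
      by (intro sum_mono) simp
    ultimately show "(\<Sum>k\<in>?X. min (?F (mvec n (g k) ` L)) C) \<le> ?N * min (?A L) C"
      unfolding sum[OF L] by (auto simp: min_def ennreal_of_nat_eq_real_of_nat)
  qed
  also have "\<dots> = ?N * (\<integral>\<^sup>+L. min (?A L) C \<partial>\<nu>)"
    by (rule nn_integral_cmult) measurable
  finally show "(\<integral>\<^sup>+L. min (?F L) C \<partial>\<nu>) \<le> (\<integral>\<^sup>+L. min (?A L) C \<partial>\<nu>)"
    by (subst (asm) ennreal_mult_le_mult_iff) (use N in auto)
qed

section \<open>Upper bounds for the horosphere averages\<close>

lemma nn_integral_hat_le:
  fixes c :: real assumes "0 \<le> c"
  shows "(\<integral>\<^sup>+t. ennreal (max 0 (c - \<bar>t\<bar>)) \<partial>lborel) \<le> ennreal (c\<^sup>2)"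
proof -
  have "(\<integral>\<^sup>+t. ennreal (max 0 (c - \<bar>t\<bar>)) \<partial>lborel)
      \<le> (\<integral>\<^sup>+t. ennreal (c - t) * indicator {0..c} t + ennreal (c + t) * indicator {- c..0} t \<partial>lborel)"
    by (intro nn_integral_mono) (auto simp: indicator_def max_def ennreal_neg)
  also have "\<dots> = (\<integral>\<^sup>+t. ennreal (c - t) * indicator {0..c} t \<partial>lborel)
      + (\<integral>\<^sup>+t. ennreal (c + t) * indicator {- c..0} t \<partial>lborel)"
    by (rule nn_integral_add) auto
  also have "(\<integral>\<^sup>+t. ennreal (c - t) * indicator {0..c} t \<partial>lborel) = ennreal ((c * c - c\<^sup>2 / 2) - (c * 0 - 0\<^sup>2 / 2))"
    by (rule nn_integral_FTC_Icc[where F = "\<lambda>t. c * t - t\<^sup>2 / 2"])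
       (use assms in \<open>auto intro!: derivative_eq_intros\<close>)
  also have "(\<integral>\<^sup>+t. ennreal (c + t) * indicator {- c..0} t \<partial>lborel) = ennreal ((c * 0 + 0\<^sup>2 / 2) - (c * (- c) + (- c)\<^sup>2 / 2))"
    by (rule nn_integral_FTC_Icc[where F = "\<lambda>t. c * t + t\<^sup>2 / 2"])
       (use assms in \<open>auto intro!: derivative_eq_intros\<close>)
  finally show ?thesis
    by (simp add: power2_eq_square flip: ennreal_plus)
qed

text \<open>On the interval from \<open>k\<close> to \<open>k + 1\<close> the argument moves by at
  most \<open>\<bar>\<beta>\<bar>\<close>, so the \<open>k\<close>-th term is at most the integral
  there of a hat widened by \<open>\<bar>\<beta>\<bar>\<close>. The intervals are disjoint, and the
  widened hat has integral at most \<open>(2 + \<bar>\<beta>\<bar>)\<^sup>2\<close>.\<close>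

lemma hat_progression_sum_le:
  assumes "\<beta> \<noteq> 0"
  shows "(\<Sum>k<M. hat (\<alpha> + \<beta> * real k)) \<le> (2 + \<bar>\<beta>\<bar>)\<^sup>2 / \<bar>\<beta>\<bar>"
proof -
  define g where "g = (\<lambda>t. ennreal (max 0 (2 + \<bar>\<beta>\<bar> - \<bar>t\<bar>)))"
  have [measurable]: "g \<in> borel_measurable borel" unfolding g_def by measurable
  have "ennreal (\<Sum>k<M. hat (\<alpha> + \<beta> * real k)) = (\<Sum>k<M. ennreal (hat (\<alpha> + \<beta> * real k)))"
    by (simp add: sum_ennreal)
  also have "\<dots> = (\<Sum>k<M. \<integral>\<^sup>+x. ennreal (hat (\<alpha> + \<beta> * real k)) * indicator {real k..<real k + 1} x \<partial>lborel)"
    by (simp add: nn_integral_cmult_indicator)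
  also have "\<dots> \<le> (\<Sum>k<M. \<integral>\<^sup>+x. g (\<alpha> + \<beta> * x) * indicator {real k..<real k + 1} x \<partial>lborel)"
  proof (intro sum_mono nn_integral_mono)
    fix k x
    have "hat (\<alpha> + \<beta> * real k) \<le> max 0 (2 + \<bar>\<beta>\<bar> - \<bar>\<alpha> + \<beta> * x\<bar>)" if "real k \<le> x" "x < real k + 1"
    proof -
      have "\<bar>\<beta> * (x - real k)\<bar> \<le> \<bar>\<beta>\<bar>" using that by (simp add: abs_mult mult_left_le)
      then have "\<bar>\<alpha> + \<beta> * x\<bar> \<le> \<bar>\<alpha> + \<beta> * real k\<bar> + \<bar>\<beta>\<bar>" by (simp add: algebra_simps)
      then show ?thesis by (auto simp: hat_def)
    qed
    then have "ennreal (hat (\<alpha> + \<beta> * real k)) \<le> g (\<alpha> + \<beta> * x)" if "x \<in> {real k..<real k + 1}"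
      using that unfolding g_def by (intro ennreal_leI) auto
    then show "ennreal (hat (\<alpha> + \<beta> * real k)) * indicator {real k..<real k + 1} x
        \<le> g (\<alpha> + \<beta> * x) * indicator {real k..<real k + 1} x"
      by (cases "x \<in> {real k..<real k + 1}") simp_all
  qed
  also have "\<dots> = (\<integral>\<^sup>+x. (\<Sum>k<M. g (\<alpha> + \<beta> * x) * indicator {real k..<real k + 1} x) \<partial>lborel)"
    by (rule nn_integral_sum[symmetric]) simp
  also have "\<dots> \<le> (\<integral>\<^sup>+x. g (\<alpha> + \<beta> * x) \<partial>lborel)"
  proof (rule nn_integral_mono)
    fix x :: real
    have "(\<Sum>k<M. indicator {real k..<real k + 1} x :: ennreal) \<le> (\<Sum>k\<in>{nat \<lfloor>x\<rfloor>}. 1)"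
    proof -
      have k: "k = nat \<lfloor>x\<rfloor>" if "real k \<le> x" "x < real k + 1" for k
        using that floor_unique[of "int k" x] by simp
      have "(\<Sum>k<M. indicator {real k..<real k + 1} x :: ennreal)
          = (\<Sum>k\<in>{..<M} \<inter> {nat \<lfloor>x\<rfloor>}. indicator {real k..<real k + 1} x)"
        by (intro sum.mono_neutral_right) (auto simp: indicator_def dest: k)
      also have "\<dots> \<le> (\<Sum>k\<in>{nat \<lfloor>x\<rfloor>}. 1)"
        by (rule order_trans[OF sum_mono[of _ _ "\<lambda>_. 1"] sum_mono2]) (auto simp: indicator_def)
      finally show ?thesis .
    qed
    then show "(\<Sum>k<M. g (\<alpha> + \<beta> * x) * indicator {real k..<real k + 1} x) \<le> g (\<alpha> + \<beta> * x)"
      by (simp add: sum_distrib_left[symmetric] mult_left_le)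
  qed
  finally have le: "ennreal \<bar>\<beta>\<bar> * ennreal (\<Sum>k<M. hat (\<alpha> + \<beta> * real k)) \<le> ennreal \<bar>\<beta>\<bar> * (\<integral>\<^sup>+x. g (\<alpha> + \<beta> * x) \<partial>lborel)"
    by (rule mult_left_mono) simp
  also have "\<dots> = (\<integral>\<^sup>+t. g t \<partial>lborel)"
    using nn_integral_real_affine[of g \<beta> \<alpha>] assms by simp
  also have "\<dots> \<le> ennreal ((2 + \<bar>\<beta>\<bar>)\<^sup>2)"
    unfolding g_def by (rule nn_integral_hat_le) simp
  finally have "\<bar>\<beta>\<bar> * (\<Sum>k<M. hat (\<alpha> + \<beta> * real k)) \<le> (2 + \<bar>\<beta>\<bar>)\<^sup>2"
    by (simp add: ennreal_mult'[symmetric])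
  then show ?thesis using assms by (simp add: field_simps)
qed

text \<open>The range of \<open>b\<close> is the one where the first factor of
  \<open>tent_avg\<close> can be nonzero. There the mesh \<open>T ^ (n + 1)\<close> makes the step
  of the progression at most \<open>2 / T\<close>.\<close>

lemma hat_avg_le:
  assumes T: "T > 0" and b: "b \<noteq> 0" "\<bar>b\<bar> \<le> 2 * real T ^ (n - 1)" and "n > 0"
  shows "hat_avg T (T ^ (n + 1)) a b \<le> (2 + 2 / real T)\<^sup>2 / (real T * \<bar>b\<bar>)"
proof -
  define M where "M = T ^ (n + 1)"
  define \<beta> where "\<beta> = real T * b / real M"
  have M: "M > 0" using T by (simp add: M_def)
  have "\<beta> \<noteq> 0" using T b M by (simp add: \<beta>_def)
  have "real T ^ (n + 1) = real T * (real T * real T ^ (n - 1))"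
    using \<open>n > 0\<close> by (cases n) auto
  then have "\<bar>\<beta>\<bar> = \<bar>b\<bar> / (real T * real T ^ (n - 1))"
    using T by (simp add: \<beta>_def M_def abs_mult)
  also have "\<dots> \<le> 2 * real T ^ (n - 1) / (real T * real T ^ (n - 1))"
    using b(2) T by (intro divide_right_mono) auto
  finally have \<beta>: "\<bar>\<beta>\<bar> \<le> 2 / real T" using T by simp
  have "hat_avg T M a b = (\<Sum>k<M. hat (real T * a + \<beta> * real k)) / real M"
    by (simp add: hat_avg_def \<beta>_def algebra_simps)
  also have "\<dots> \<le> ((2 + \<bar>\<beta>\<bar>)\<^sup>2 / \<bar>\<beta>\<bar>) / real M"
    using hat_progression_sum_le[OF \<open>\<beta> \<noteq> 0\<close>] by (intro divide_right_mono) auto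
  also have "\<dots> = (2 + \<bar>\<beta>\<bar>)\<^sup>2 / (real T * \<bar>b\<bar>)"
    using M by (simp add: \<beta>_def abs_mult field_simps)
  also have "\<dots> \<le> (2 + 2 / real T)\<^sup>2 / (real T * \<bar>b\<bar>)"
    using \<beta> T by (intro divide_right_mono power_mono) auto
  finally show ?thesis by (simp add: M_def)
qed

text \<open>A nonzero average forces \<open>a\<close> to lie within \<open>2 / T\<close> of the
  segment from 0 to \<open>- b\<close>. This confines the remaining coordinates of a contributing
  lattice vector to a strip determined by coordinate 0.\<close>

lemma hat_avg_support:
  assumes "T > 0" "hat_avg T M a b \<noteq> 0"
  obtains x where "0 \<le> x" "x \<le> 1" "real T * \<bar>a + x * b\<bar> < 2"
proof -
  have "\<exists>k\<in>{..<M}. hat (real T * (a + real k / real M * b)) \<noteq> 0"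
    using assms(2) sum.neutral[of "{..<M}"] unfolding hat_avg_def by force
  then obtain k where k: "k < M" "hat (real T * (a + real k / real M * b)) \<noteq> 0" by blast
  then have "\<bar>real T * (a + real k / real M * b)\<bar> < 2" using hat_zero not_less by blast
  then show ?thesis using k by (intro that[of "real k / real M"]) (auto simp: abs_mult)
qed

text \<open>An upper bound for \<open>tent_avg n T\<close> at all points within \<open>\<rho>\<close> of \<open>v\<close>, valid away from the hyperplane
  \<open>v 0 = 0\<close>, where the averaged function is singular.\<close>

definition slab_majorant :: "nat \<Rightarrow> nat \<Rightarrow> real \<Rightarrow> real \<Rightarrow> (nat \<Rightarrow> real) \<Rightarrow> ennreal" where
  "slab_majorant n T \<rho> A v =
     (if \<bar>v 0\<bar> > A - \<rho> then ennreal (max 0 (2 + \<rho> / real T ^ (n - 1) - \<bar>v 0 / real T ^ (n - 1)\<bar>)) else 0) *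
     (\<Prod>i\<in>{1..<n}. ennreal ((2 + 2 / real T)\<^sup>2 * (1 + \<rho> / A) / (real T * \<bar>v 0\<bar>)) *
       (if min (- v 0) 0 - (2 + 2 * \<rho>) \<le> v i \<and> v i \<le> max (- v 0) 0 + (2 + 2 * \<rho>) then 1 else 0))"

lemma measurable_slab_majorant [measurable]:
  assumes "n > 0"
  shows "slab_majorant n T \<rho> A \<in> borel_measurable (Leb {..<n})"
proof -
  have coord: "(\<lambda>v. v i) \<in> borel_measurable (Leb {..<n})" if "i < n" for i
    using measurable_component_singleton[of i "{..<n}" "\<lambda>_. lborel"] that by simp
  note [measurable] = coord[OF assms]
  show ?thesis
    unfolding slab_majorant_def
  proof (intro borel_measurable_times_ennreal borel_measurable_prod_ennreal)
    fix i assume "i \<in> {1..<n}"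
    then have "(\<lambda>v. v i) \<in> borel_measurable (Leb {..<n})" by (intro coord) simp
    with coord[OF assms] have pair: "(\<lambda>v. (v 0, v i)) \<in> measurable (Leb {..<n}) (borel \<Otimes>\<^sub>M borel)"
      by (rule measurable_Pair)
    have "(\<lambda>p. if min (- fst p) 0 - (2 + 2 * \<rho>) \<le> snd p \<and> snd p \<le> max (- fst p) 0 + (2 + 2 * \<rho>) then 1 else 0 :: ennreal)
        \<in> borel_measurable (borel \<Otimes>\<^sub>M borel)" by measurable
    from measurable_compose[OF pair this]
    show "(\<lambda>v. if min (- v 0) 0 - (2 + 2 * \<rho>) \<le> v i \<and> v i \<le> max (- v 0) 0 + (2 + 2 * \<rho>) then 1 else 0 :: ennreal)
        \<in> borel_measurable (Leb {..<n})" by simp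
  qed measurable
qed

text \<open>Passing from \<open>w\<close> to \<open>v\<close> widens the first hat by
  \<open>\<rho> / T ^ (n - 1)\<close> and replaces \<open>1 / \<bar>w 0\<bar>\<close> by at most
  \<open>(1 + \<rho> / A) / \<bar>v 0\<bar>\<close>. The strip grows by \<open>2 * \<rho>\<close>,
  one \<open>\<rho>\<close> for coordinate \<open>i\<close> and one for coordinate 0 multiplied by
  \<open>x\<close>.\<close>

lemma tent_avg_le_majorant:
  assumes T: "T > 0" and n: "n > 0" and \<rho>: "0 < \<rho>" "\<rho> < A" and w: "A < \<bar>w 0\<bar>"
    and near: "\<And>i. i < n \<Longrightarrow> \<bar>v i - w i\<bar> \<le> \<rho>"
  shows "ennreal (tent_avg n T w) \<le> slab_majorant n T \<rho> A v"
proof (cases "tent_avg n T w = 0")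
  case False
  let ?\<tau> = "real T ^ (n - 1)"
  have v0: "\<bar>v 0 - w 0\<bar> \<le> \<rho>" using near n by blast
  then have v0A: "\<bar>v 0\<bar> > A - \<rho>" "v 0 \<noteq> 0" using w \<rho> by auto
  have "hat (w 0 / ?\<tau>) \<noteq> 0" using False by (auto simp: tent_avg_def)
  then have "\<bar>w 0 / ?\<tau>\<bar> < 2" using hat_zero not_less by blast
  then have w0: "\<bar>w 0\<bar> \<le> 2 * ?\<tau>" using T by (simp add: abs_divide field_simps)
  have "\<bar>v 0 / ?\<tau>\<bar> \<le> \<bar>w 0 / ?\<tau>\<bar> + \<rho> / ?\<tau>"
  proof -
    have "\<bar>v 0\<bar> \<le> \<bar>w 0\<bar> + \<rho>" using v0 by linarith
    then have "\<bar>v 0\<bar> / ?\<tau> \<le> (\<bar>w 0\<bar> + \<rho>) / ?\<tau>" using T by (intro divide_right_mono) auto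
    then show ?thesis by (simp add: abs_divide add_divide_distrib)
  qed
  then have first: "hat (w 0 / ?\<tau>) \<le> max 0 (2 + \<rho> / ?\<tau> - \<bar>v 0 / ?\<tau>\<bar>)"
    unfolding hat_def by linarith
  have factor: "ennreal (hat_avg T (T ^ (n + 1)) (w i) (w 0))
      \<le> ennreal ((2 + 2 / real T)\<^sup>2 * (1 + \<rho> / A) / (real T * \<bar>v 0\<bar>)) *
        (if min (- v 0) 0 - (2 + 2 * \<rho>) \<le> v i \<and> v i \<le> max (- v 0) 0 + (2 + 2 * \<rho>) then 1 else 0)"
    if i: "i \<in> {1..<n}" for i
  proof -
    have "hat_avg T (T ^ (n + 1)) (w i) (w 0) \<noteq> 0"
      using False i by (auto simp: tent_avg_def)
    then obtain x where x: "0 \<le> x" "x \<le> 1" "real T * \<bar>w i + x * w 0\<bar> < 2"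
      using hat_avg_support[OF T] by blast
    have "1 * \<bar>w i + x * w 0\<bar> \<le> real T * \<bar>w i + x * w 0\<bar>" using T by (intro mult_right_mono) auto
    then have x2: "\<bar>w i + x * w 0\<bar> < 2" using x by simp
    have "\<bar>x * (v 0 - w 0)\<bar> \<le> \<rho>"
      using mult_mono[of "\<bar>x\<bar>" 1 "\<bar>v 0 - w 0\<bar>" \<rho>] x v0 by (simp add: abs_mult)
    moreover have "\<bar>v i - w i\<bar> \<le> \<rho>" using near i by auto
    moreover have "v i + x * v 0 = (w i + x * w 0) + (v i - w i) + x * (v 0 - w 0)"
      by (simp add: algebra_simps)
    ultimately have "\<bar>v i + x * v 0\<bar> \<le> 2 + 2 * \<rho>" using x2 by linarith
    moreover have "min (- v 0) 0 \<le> - (x * v 0)" "- (x * v 0) \<le> max (- v 0) 0"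
    proof -
      have "x * v 0 \<le> max (v 0) 0" "min (v 0) 0 \<le> x * v 0"
        using x mult_left_le_one_le[of "v 0" x] mult_left_le_one_le[of "- v 0" x]
          mult_nonneg_nonneg[of x "v 0"] mult_nonneg_nonneg[of x "- v 0"]
        by (cases "0 \<le> v 0"; auto simp: max_def min_def)+
      then show "min (- v 0) 0 \<le> - (x * v 0)" "- (x * v 0) \<le> max (- v 0) 0" by linarith+
    qed
    ultimately have strip: "min (- v 0) 0 - (2 + 2 * \<rho>) \<le> v i" "v i \<le> max (- v 0) 0 + (2 + 2 * \<rho>)"
      by linarith+
    have "hat_avg T (T ^ (n + 1)) (w i) (w 0) \<le> (2 + 2 / real T)\<^sup>2 / (real T * \<bar>w 0\<bar>)"
      using w \<rho> w0 n T by (intro hat_avg_le) auto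
    also have "\<dots> \<le> (2 + 2 / real T)\<^sup>2 * (1 + \<rho> / A) / (real T * \<bar>v 0\<bar>)"
    proof -
      have "\<bar>v 0\<bar> * A \<le> (\<bar>w 0\<bar> + \<rho>) * A" using v0 \<rho> by (intro mult_right_mono) auto
      also have "\<dots> \<le> (A + \<rho>) * \<bar>w 0\<bar>" using w \<rho> by (simp add: algebra_simps)
      finally have "1 / \<bar>w 0\<bar> \<le> (1 + \<rho> / A) / \<bar>v 0\<bar>"
        using w \<rho> v0A by (simp add: field_simps)
      then have "(2 + 2 / real T)\<^sup>2 / real T * (1 / \<bar>w 0\<bar>) \<le> (2 + 2 / real T)\<^sup>2 / real T * ((1 + \<rho> / A) / \<bar>v 0\<bar>)"
        by (intro mult_left_mono) auto
      then show ?thesis by simp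
    qed
    finally show ?thesis using strip by (auto intro!: ennreal_leI)
  qed
  have "ennreal (tent_avg n T w)
      = ennreal (hat (w 0 / ?\<tau>)) * (\<Prod>i\<in>{1..<n}. ennreal (hat_avg T (T ^ (n + 1)) (w i) (w 0)))"
    by (simp add: tent_avg_def ennreal_mult' prod_ennreal prod_nonneg)
  also have "\<dots> \<le> slab_majorant n T \<rho> A v"
  proof -
    have "ennreal (hat (w 0 / ?\<tau>)) \<le> (if \<bar>v 0\<bar> > A - \<rho>
        then ennreal (max 0 (2 + \<rho> / ?\<tau> - \<bar>v 0 / ?\<tau>\<bar>)) else 0)"
      using v0A(1) ennreal_leI[OF first] by (simp only: if_True)
    then show ?thesis
      unfolding slab_majorant_def by (intro mult_mono prod_mono_ennreal factor) simp_all
  qed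
  finally show ?thesis .
qed simp

text \<open>For fixed \<open>y = v 0\<close> each strip has length
  \<open>\<bar>y\<bar> + 4 + 4 * \<rho>\<close>, which cancels the decay in
  \<open>\<bar>y\<bar>\<close> up to a factor close to 1 for large \<open>A\<close>. The remaining
  powers of \<open>1 / T\<close> cancel against the rescaling of coordinate 0.\<close>

lemma nn_integral_slab_majorant_le:
  assumes T: "T > 0" and n: "n > 0" and \<rho>: "0 < \<rho>" "\<rho> < A"
  shows "(\<integral>\<^sup>+v. slab_majorant n T \<rho> A v \<partial>Leb {..<n})
    \<le> ennreal (((2 + 2 / real T)\<^sup>2 * (1 + \<rho> / A) * (1 + (4 + 4 * \<rho>) / (A - \<rho>))) ^ (n - 1)
        * (2 + \<rho> / real T ^ (n - 1))\<^sup>2)"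
proof -
  let ?\<tau> = "real T ^ (n - 1)" and ?J = "{1..<n}" and ?q = "1 + (4 + 4 * \<rho>) / (A - \<rho>)"
  define \<kappa> where "\<kappa> = (2 + 2 / real T)\<^sup>2 * (1 + \<rho> / A)"
  have \<kappa>: "\<kappa> \<ge> 0" using \<rho> by (simp add: \<kappa>_def)
  have nonneg: "0 \<le> \<kappa> * ?q / real T" using \<kappa> \<rho> by simp
  define G where "G = (\<lambda>y::real. ennreal (max 0 (2 + \<rho> / ?\<tau> - \<bar>y / ?\<tau>\<bar>)))"
  have [measurable]: "G \<in> borel_measurable borel" unfolding G_def by measurable
  define s where "s = (\<lambda>y t::real. if min (- y) 0 - (2 + 2 * \<rho>) \<le> t \<and> t \<le> max (- y) 0 + (2 + 2 * \<rho>) then 1 else 0 :: ennreal)"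
  have split: "{..<n} = insert 0 ?J" using n by auto
  have strip: "(\<integral>\<^sup>+t. ennreal (\<kappa> / (real T * \<bar>y\<bar>)) * s y t \<partial>lborel) \<le> ennreal (\<kappa> * ?q / real T)"
    if y: "\<bar>y\<bar> > A - \<rho>" for y
  proof -
    let ?l = "min (- y) 0 - (2 + 2 * \<rho>)" and ?u = "max (- y) 0 + (2 + 2 * \<rho>)"
    have "s y = indicator {?l..?u}"
      by (auto simp: s_def fun_eq_iff indicator_def)
    moreover have "emeasure lborel {?l..?u} = ennreal (\<bar>y\<bar> + (4 + 4 * \<rho>))"
    proof -
      have "?u - ?l = \<bar>y\<bar> + (4 + 4 * \<rho>)" by (auto simp: max_def min_def)
      moreover have "?l \<le> ?u" using \<rho> by (auto simp: max_def min_def)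
      ultimately show ?thesis by (simp only: emeasure_lborel_Icc)
    qed
    ultimately have "(\<integral>\<^sup>+t. ennreal (\<kappa> / (real T * \<bar>y\<bar>)) * s y t \<partial>lborel)
        = ennreal (\<kappa> / (real T * \<bar>y\<bar>)) * ennreal (\<bar>y\<bar> + (4 + 4 * \<rho>))"
      by (simp only: nn_integral_cmult_indicator sets_lborel atLeastAtMost_borel)
    also have "\<dots> = ennreal (\<kappa> / real T * (1 + (4 + 4 * \<rho>) / \<bar>y\<bar>))"
      using y \<rho> \<kappa> T by (subst ennreal_mult'[symmetric]) (auto simp: field_simps intro!: arg_cong[where f = ennreal])
    also have "\<dots> \<le> ennreal (\<kappa> / real T * ?q)"
      using y \<rho> \<kappa> T by (intro ennreal_leI mult_left_mono add_left_mono divide_left_mono mult_pos_pos) auto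
    finally show ?thesis by simp
  qed
  have "(\<integral>\<^sup>+v. slab_majorant n T \<rho> A v \<partial>Leb {..<n})
      = (\<integral>\<^sup>+y. \<integral>\<^sup>+x. slab_majorant n T \<rho> A (x(0 := y)) \<partial>Leb ?J \<partial>lborel)"
  proof -
    have "slab_majorant n T \<rho> A \<in> borel_measurable (Leb (insert 0 ?J))"
      unfolding split[symmetric] by (rule measurable_slab_majorant[OF n])
    then show ?thesis
      unfolding split by (intro lborel_prod.product_nn_integral_insert_rev) auto
  qed
  also have "\<dots> \<le> (\<integral>\<^sup>+y. ennreal ((\<kappa> * ?q / real T) ^ (n - 1)) * G y \<partial>lborel)"
  proof (rule nn_integral_mono)
    fix y :: real
    have [measurable]: "s y \<in> borel_measurable borel" unfolding s_def by measurable
    have "(\<integral>\<^sup>+x. slab_majorant n T \<rho> A (x(0 := y)) \<partial>Leb ?J)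
        = (\<integral>\<^sup>+x. (if \<bar>y\<bar> > A - \<rho> then G y else 0) * (\<Prod>i\<in>?J. ennreal (\<kappa> / (real T * \<bar>y\<bar>)) * s y (x i)) \<partial>Leb ?J)"
      unfolding slab_majorant_def G_def s_def \<kappa>_def
      by (intro nn_integral_cong arg_cong2[where f = times] prod.cong) auto
    also have "\<dots> = (if \<bar>y\<bar> > A - \<rho> then G y else 0)
        * (\<integral>\<^sup>+x. (\<Prod>i\<in>?J. ennreal (\<kappa> / (real T * \<bar>y\<bar>)) * s y (x i)) \<partial>Leb ?J)"
      by (rule nn_integral_cmult) measurable
    also have "(\<integral>\<^sup>+x. (\<Prod>i\<in>?J. ennreal (\<kappa> / (real T * \<bar>y\<bar>)) * s y (x i)) \<partial>Leb ?J)
        = (\<Prod>i\<in>?J. \<integral>\<^sup>+t. ennreal (\<kappa> / (real T * \<bar>y\<bar>)) * s y t \<partial>lborel)"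
      by (rule lborel_prod.product_nn_integral_prod) auto
    also have "(if \<bar>y\<bar> > A - \<rho> then G y else 0) * \<dots> \<le> G y * ennreal (\<kappa> * ?q / real T) ^ (n - 1)"
    proof (cases "\<bar>y\<bar> > A - \<rho>")
      case True
      have "(\<Prod>i\<in>?J. \<integral>\<^sup>+t. ennreal (\<kappa> / (real T * \<bar>y\<bar>)) * s y t \<partial>lborel) \<le> (\<Prod>i\<in>?J. ennreal (\<kappa> * ?q / real T))"
        by (intro prod_mono_ennreal strip True)
      then show ?thesis using True by (simp add: mult_left_mono)
    qed simp
    also have "\<dots> = ennreal ((\<kappa> * ?q / real T) ^ (n - 1)) * G y"
      unfolding ennreal_power[OF nonneg] by (rule mult.commute)
    finally show "(\<integral>\<^sup>+x. slab_majorant n T \<rho> A (x(0 := y)) \<partial>Leb ?J) \<le> ennreal ((\<kappa> * ?q / real T) ^ (n - 1)) * G y" .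
  qed
  also have "\<dots> = ennreal ((\<kappa> * ?q / real T) ^ (n - 1)) * (\<integral>\<^sup>+y. G y \<partial>lborel)"
    by (rule nn_integral_cmult) simp
  also have "(\<integral>\<^sup>+y. G y \<partial>lborel) = ennreal ?\<tau> * (\<integral>\<^sup>+t. ennreal (max 0 (2 + \<rho> / ?\<tau> - \<bar>t\<bar>)) \<partial>lborel)"
  proof -
    have eq: "G (0 + ?\<tau> * t) = ennreal (max 0 (2 + \<rho> / ?\<tau> - \<bar>t\<bar>))" for t
    proof -
      have "?\<tau> * t / ?\<tau> = t" using T by simp
      then show ?thesis unfolding G_def by (simp only: add_0)
    qed
    have "(\<integral>\<^sup>+y. G y \<partial>lborel) = ennreal \<bar>?\<tau>\<bar> * (\<integral>\<^sup>+t. G (0 + ?\<tau> * t) \<partial>lborel)"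
      by (rule nn_integral_real_affine) (use T in auto)
    moreover have "\<bar>?\<tau>\<bar> = ?\<tau>" by simp
    ultimately show ?thesis unfolding eq by (simp only:)
  qed
  also have "ennreal ((\<kappa> * ?q / real T) ^ (n - 1)) * \<dots> \<le> ennreal ((\<kappa> * ?q / real T) ^ (n - 1)) * (ennreal ?\<tau> * ennreal ((2 + \<rho> / ?\<tau>)\<^sup>2))"
    using \<rho> by (intro mult_left_mono nn_integral_hat_le) auto
  also have "\<dots> = ennreal ((\<kappa> * ?q) ^ (n - 1) * (2 + \<rho> / ?\<tau>)\<^sup>2)"
  proof -
    have "ennreal ((\<kappa> * ?q / real T) ^ (n - 1)) * (ennreal ?\<tau> * ennreal ((2 + \<rho> / ?\<tau>)\<^sup>2))
        = ennreal ((\<kappa> * ?q / real T) ^ (n - 1) * (?\<tau> * (2 + \<rho> / ?\<tau>)\<^sup>2))"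
      using zero_le_power[OF nonneg, of "n - 1"] by (simp only: ennreal_mult' zero_le_power of_nat_0_le_iff)
    also have "(\<kappa> * ?q / real T) ^ (n - 1) * (?\<tau> * (2 + \<rho> / ?\<tau>)\<^sup>2) = (\<kappa> * ?q) ^ (n - 1) * (2 + \<rho> / ?\<tau>)\<^sup>2"
      using T by (simp only: power_divide) simp
    finally show ?thesis .
  qed
  finally show ?thesis by (simp add: \<kappa>_def)
qed

section \<open>The mean value inequality\<close>

text \<open>The image of the unit cube under \<open>B\<close>, translated to each lattice point,
  tiles space by cells of volume one that stay within \<open>\<rho>\<close> of that point in every
  coordinate. So each term is at most the integral of \<open>h\<close> over its own cell.\<close>

lemma sum_lvec_le_integral:
  assumes det: "mdet n B = 1" and [measurable]: "h \<in> borel_measurable (Leb {..<n})"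
    and \<rho>: "\<And>i. i < n \<Longrightarrow> (\<Sum>j<n. \<bar>B (i, j)\<bar>) \<le> \<rho>"
    and le: "\<And>c v. (\<And>i. i < n \<Longrightarrow> \<bar>v i - lvec n B c i\<bar> \<le> \<rho>) \<Longrightarrow> f (lvec n B c) \<le> h v"
  shows "(\<integral>\<^sup>+c. f (lvec n B c) \<partial>count_space (Zn n)) \<le> (\<integral>\<^sup>+v. h v \<partial>Leb {..<n})"
proof -
  have "f (lvec n B c) \<le> h (lin n B (zshift n u c))" if u: "u \<in> unit_cube n" for c u
  proof (rule le)
    fix i assume i: "i < n"
    have "\<bar>\<Sum>j<n. B (i, j) * u j\<bar> \<le> (\<Sum>j<n. \<bar>B (i, j) * u j\<bar>)" by (rule sum_abs)
    also have "\<dots> \<le> (\<Sum>j<n. \<bar>B (i, j)\<bar>)"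
      using u by (intro sum_mono) (auto simp: unit_cube_def PiE_iff abs_mult less_imp_le intro!: mult_left_le)
    also have "\<dots> \<le> \<rho>" by (rule \<rho>[OF i])
    finally show "\<bar>lin n B (zshift n u c) i - lvec n B c i\<bar> \<le> \<rho>"
      unfolding lin_zshift using i by (simp add: vadd_def lin_def)
  qed
  then have "f (lvec n B c) * indicator (unit_cube n) u \<le> h (lin n B (zshift n u c)) * indicator (unit_cube n) u" for c u
    by (cases "u \<in> unit_cube n") auto
  then have "(\<integral>\<^sup>+u. f (lvec n B c) * indicator (unit_cube n) u \<partial>Leb {..<n})
      \<le> (\<integral>\<^sup>+u. h (lin n B (zshift n u c)) * indicator (unit_cube n) u \<partial>Leb {..<n})" for c
    by (intro nn_integral_mono)
  then have "f (lvec n B c) \<le> (\<integral>\<^sup>+u. h (lin n B (zshift n u c)) * indicator (unit_cube n) u \<partial>Leb {..<n})" for c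
    by (simp add: nn_integral_cmult_indicator emeasure_unit_cube)
  then have "(\<integral>\<^sup>+c. f (lvec n B c) \<partial>count_space (Zn n))
      \<le> (\<integral>\<^sup>+c. \<integral>\<^sup>+u. h (lin n B (zshift n u c)) * indicator (unit_cube n) u \<partial>Leb {..<n} \<partial>count_space (Zn n))"
    by (intro nn_integral_mono)
  also have "\<dots> = (\<integral>\<^sup>+y. h (lin n B y) \<partial>Leb {..<n})"
    by (rule nn_integral_unfold) simp
  also have "\<dots> = (\<integral>\<^sup>+v. h v \<partial>Leb {..<n})"
    by (rule nn_integral_lin) (use det in auto)
  finally show ?thesis .
qed

text \<open>Counting by volume: the comparison lemma bounds the number of points by the volume of a
  box enlarged by \<open>\<rho>\<close>.\<close>

lemma finite_lattice_points:
  assumes det: "mdet n B = 1"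
  shows "finite {c \<in> Zn n. \<forall>i<n. \<bar>lvec n B c i\<bar> \<le> R}"
proof -
  define \<rho> where "\<rho> = (\<Sum>i<n. \<Sum>j<n. \<bar>B (i, j)\<bar>)"
  have \<rho>: "(\<Sum>j<n. \<bar>B (i, j)\<bar>) \<le> \<rho>" if "i < n" for i
    unfolding \<rho>_def using that by (intro member_le_sum) (auto intro: sum_nonneg)
  let ?f = "\<lambda>w. if \<forall>i<n. \<bar>w i\<bar> \<le> R then 1 else 0 :: ennreal"
  have "(\<integral>\<^sup>+c. ?f (lvec n B c) \<partial>count_space (Zn n))
      \<le> (\<integral>\<^sup>+v. (\<Prod>i<n. indicator {- (R + \<rho>)..R + \<rho>} (v i)) \<partial>Leb {..<n})"
  proof (rule sum_lvec_le_integral[OF det _ \<rho>, where f = ?f])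
    fix c and v :: "nat \<Rightarrow> real" assume v: "\<And>i. i < n \<Longrightarrow> \<bar>v i - lvec n B c i\<bar> \<le> \<rho>"
    have "indicator {- (R + \<rho>)..R + \<rho>} (v i) = (1 :: ennreal)" if "\<forall>i<n. \<bar>lvec n B c i\<bar> \<le> R" "i < n" for i
    proof -
      have "\<bar>lvec n B c i\<bar> \<le> R" using that by blast
      with v[OF that(2)] have "- (R + \<rho>) \<le> v i" "v i \<le> R + \<rho>" by linarith+
      then show ?thesis by simp
    qed
    then show "?f (lvec n B c) \<le> (\<Prod>i<n. indicator {- (R + \<rho>)..R + \<rho>} (v i))" by simp
  qed measurable
  also have "\<dots> = (\<Prod>i<n. \<integral>\<^sup>+t. indicator {- (R + \<rho>)..R + \<rho>} t \<partial>lborel)"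
    by (rule lborel_prod.product_nn_integral_prod) auto
  also have "\<dots> < \<top>" by (auto simp: emeasure_lborel_Icc_eq ennreal_power power_less_top_ennreal)
  finally have "(\<integral>\<^sup>+c. indicator {c \<in> Zn n. \<forall>i<n. \<bar>lvec n B c i\<bar> \<le> R} c \<partial>count_space (Zn n)) < \<top>"
    by (rule le_less_trans[rotated]) (intro nn_integral_mono, auto simp: indicator_def)
  then show ?thesis
    by (subst (asm) nn_integral_indicator) (auto simp: emeasure_count_space split: if_splits)
qed

text \<open>If \<open>w 0 = 0\<close>, another coordinate is nonzero and its factor vanishes exactly
  for large \<open>T\<close>. Otherwise each factor with \<open>i > 0\<close> is of order
  \<open>1 / (T * \<bar>w 0\<bar>)\<close>, and \<open>n \<ge> 2\<close> provides at least one such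
  factor.\<close>

lemma tent_avg_tendsto_0:
  assumes n: "n \<ge> 2" and w: "w \<noteq> (\<lambda>_. 0)" "w \<in> rvecs n"
  shows "(\<lambda>T. tent_avg n T w) \<longlonglongrightarrow> 0"
proof (cases "w 0 = 0")
  case True
  obtain i where i: "w i \<noteq> 0" using w(1) by auto
  then have "i \<in> {1..<n}" using True w(2) by (cases "i < n"; cases i) (auto simp: rvecs_def)
  have zero: "tent_avg n T w = 0" if T: "real T \<ge> 2 / \<bar>w i\<bar>" "T > 0" for T
  proof -
    have "2 \<le> real T * \<bar>w i\<bar>" using T i by (simp add: field_simps)
    then have "hat_avg T (T ^ (n + 1)) (w i) (w 0) = 0"
      using T True by (simp add: hat_avg_def hat_zero abs_mult)
    then show ?thesis using \<open>i \<in> {1..<n}\<close> by (auto simp: tent_avg_def)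
  qed
  have "eventually (\<lambda>T. real T \<ge> 2 / \<bar>w i\<bar>) sequentially"
    using filterlim_real_sequentially by (auto simp: filterlim_at_top)
  with eventually_gt_at_top[of 0] have "eventually (\<lambda>T. tent_avg n T w = 0) sequentially"
  proof eventually_elim
    case (elim T)
    then show ?case by (intro zero)
  qed
  then show ?thesis by (rule tendsto_eventually)
next
  case False
  have "(\<lambda>T. hat_avg T (T ^ (n + 1)) (w i) (w 0)) \<longlonglongrightarrow> 0" for i
  proof (rule tendsto_sandwich[OF _ _ tendsto_const])
    have T: "eventually (\<lambda>T. real T \<ge> \<bar>w 0\<bar>) sequentially"
      using filterlim_real_sequentially by (auto simp: filterlim_at_top)
    show "eventually (\<lambda>T. hat_avg T (T ^ (n + 1)) (w i) (w 0) \<le> 16 / (real T * \<bar>w 0\<bar>)) sequentially"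
      using T eventually_gt_at_top[of 0]
    proof eventually_elim
      case (elim T)
      have "real T \<le> real T ^ (n - 1)" using elim n by (intro self_le_power) auto
      then have "\<bar>w 0\<bar> \<le> 2 * real T ^ (n - 1)" using elim by linarith
      then have "hat_avg T (T ^ (n + 1)) (w i) (w 0) \<le> (2 + 2 / real T)\<^sup>2 / (real T * \<bar>w 0\<bar>)"
        using elim False n by (intro hat_avg_le) auto
      also have "\<dots> \<le> 4\<^sup>2 / (real T * \<bar>w 0\<bar>)"
        using elim by (intro divide_right_mono power_mono) (auto simp: field_simps)
      finally show ?case by simp
    qed
    have "(\<lambda>T. 16 / \<bar>w 0\<bar> * (1 / real T)) \<longlonglongrightarrow> 16 / \<bar>w 0\<bar> * 0"
      by (intro tendsto_mult tendsto_const lim_1_over_n)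
    then show "(\<lambda>T. 16 / (real T * \<bar>w 0\<bar>)) \<longlonglongrightarrow> 0" by (simp add: mult.commute)
  qed simp
  then have "(\<lambda>T. 2 * (\<Prod>i\<in>{1..<n}. hat_avg T (T ^ (n + 1)) (w i) (w 0))) \<longlonglongrightarrow> 2 * (\<Prod>i\<in>{1..<n}. 0)"
    by (intro tendsto_mult tendsto_const tendsto_prod)
  moreover have "(\<Prod>i\<in>{1..<n}. 0 :: real) = 0" using n by simp
  ultimately have lim: "(\<lambda>T. 2 * (\<Prod>i\<in>{1..<n}. hat_avg T (T ^ (n + 1)) (w i) (w 0))) \<longlonglongrightarrow> 0"
    by (simp only: mult_zero_right)
  show ?thesis
    by (rule tendsto_sandwich[OF _ _ tendsto_const lim])
       (auto simp: tent_avg_def intro!: always_eventually mult_right_mono hat_le prod_nonneg mult_nonneg_nonneg)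
qed

text \<open>The order of the limits matters: first \<open>T\<close> tends to infinity for a fixed
  cutoff \<open>A\<close>, which gives the bound \<open>K A\<close>, and only then does
  \<open>A\<close> grow.\<close>

lemma limsup_lattice_sum_tent_avg:
  assumes B: "B \<in> SLn n" and n: "n \<ge> 2"
  shows "limsup (\<lambda>T. lattice_sum (\<lambda>w. ennreal (tent_avg n T w)) (lat n B)) \<le> 4 ^ n"
proof -
  have det: "mdet n B = 1" using B by (simp add: SLn_def)
  then have nz: "mdet n B \<noteq> 0" by simp
  define \<rho> where "\<rho> = 1 + (\<Sum>i<n. \<Sum>j<n. \<bar>B (i, j)\<bar>)"
  have "\<rho> > 0" by (auto simp: \<rho>_def intro!: add_pos_nonneg sum_nonneg)
  have \<rho>: "(\<Sum>j<n. \<bar>B (i, j)\<bar>) \<le> \<rho>" if "i < n" for i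
  proof -
    have "(\<Sum>j<n. \<bar>B (i, j)\<bar>) \<le> (\<Sum>i<n. \<Sum>j<n. \<bar>B (i, j)\<bar>)"
      using that by (intro member_le_sum) (auto intro: sum_nonneg)
    then show ?thesis by (simp add: \<rho>_def)
  qed
  let ?S = "\<lambda>T. lattice_sum (\<lambda>w. ennreal (tent_avg n T w)) (lat n B)"
  define K where "K = (\<lambda>A. (4 * (1 + \<rho> / A) * (1 + (4 + 4 * \<rho>) / (A - \<rho>))) ^ (n - 1) * 4)"
  have bound: "limsup ?S \<le> ennreal (K A)" if A: "A > \<rho>" for A
  proof -
    \<comment> \<open>Lattice vectors with \<open>\<bar>w 0\<bar> > A\<close> are handled by the majorant. The others contribute only through the finite
      set \<open>D\<close>, where each term vanishes in the limit.\<close>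
    define D where "D = {c \<in> Zn n. \<forall>i<n. \<bar>lvec n B c i\<bar> \<le> A + 2} \<inter> {c. lvec n B c \<noteq> (\<lambda>_. 0)}"
    have fin: "finite D" unfolding D_def using finite_lattice_points[OF det] by blast
    define K' where "K' = (\<lambda>T. ((2 + 2 / real T)\<^sup>2 * (1 + \<rho> / A) * (1 + (4 + 4 * \<rho>) / (A - \<rho>))) ^ (n - 1)
        * (2 + \<rho> / real T ^ (n - 1))\<^sup>2)"
    define E where "E = (\<lambda>T. \<Sum>c\<in>D. tent_avg n T (lvec n B c))"
    have K'_nonneg: "K' T \<ge> 0" for T using A \<open>\<rho> > 0\<close> by (simp add: K'_def)
    have le: "?S T \<le> ennreal (K' T + E T)" if T: "T > 0" for T
    proof -
      let ?f = "\<lambda>w. if A < \<bar>w 0\<bar> then ennreal (tent_avg n T w) else 0"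
      have "?S T \<le> (\<integral>\<^sup>+c. ?f (lvec n B c) + ennreal (tent_avg n T (lvec n B c)) * indicator D c \<partial>count_space (Zn n))"
        unfolding lattice_sum_lat(2)[OF nz]
      proof (rule nn_integral_mono)
        fix c assume "c \<in> space (count_space (Zn n))"
        then have c: "c \<in> Zn n" by simp
        show "ennreal (tent_avg n T (lvec n B c)) * indicator {c. lvec n B c \<noteq> (\<lambda>_. 0)} c
            \<le> ?f (lvec n B c) + ennreal (tent_avg n T (lvec n B c)) * indicator D c"
        proof (cases "A < \<bar>lvec n B c 0\<bar> \<or> lvec n B c = (\<lambda>_. 0) \<or> tent_avg n T (lvec n B c) = 0 \<or> c \<in> D")
          \<comment> \<open>Here coordinate 0 is at most \<open>A\<close> in absolute value, so a
            nonzero average would put every other coordinate below \<open>A + 2\<close>. This is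
            where the radius in \<open>D\<close> comes from.\<close>
          case False
          then obtain i where i: "i < n" "\<bar>lvec n B c i\<bar> > A + 2" using c by (auto simp: D_def not_le)
          then have "i \<in> {1..<n}" using False by (cases i) auto
          then have "hat_avg T (T ^ (n + 1)) (lvec n B c i) (lvec n B c 0) \<noteq> 0"
            using False by (auto simp: tent_avg_def)
          then obtain x where x: "0 \<le> x" "x \<le> 1" "real T * \<bar>lvec n B c i + x * lvec n B c 0\<bar> < 2"
            using hat_avg_support[OF T] by blast
          have "1 * \<bar>lvec n B c i + x * lvec n B c 0\<bar> \<le> real T * \<bar>lvec n B c i + x * lvec n B c 0\<bar>"
            using T by (intro mult_right_mono) auto
          then have "\<bar>lvec n B c i + x * lvec n B c 0\<bar> < 2" using x(3) by simp
          moreover have "\<bar>x * lvec n B c 0\<bar> \<le> A"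
            using mult_mono[of "\<bar>x\<bar>" 1 "\<bar>lvec n B c 0\<bar>" A] x False by (simp add: abs_mult)
          ultimately have False using i(2) by linarith
          then show ?thesis ..
        qed (auto simp: indicator_def)
      qed
      also have "\<dots> = (\<integral>\<^sup>+c. ?f (lvec n B c) \<partial>count_space (Zn n))
          + (\<integral>\<^sup>+c. ennreal (tent_avg n T (lvec n B c)) * indicator D c \<partial>count_space (Zn n))"
        by (rule nn_integral_add) auto
      also have "(\<integral>\<^sup>+c. ?f (lvec n B c) \<partial>count_space (Zn n)) \<le> (\<integral>\<^sup>+v. slab_majorant n T \<rho> A v \<partial>Leb {..<n})"
      proof (rule sum_lvec_le_integral[OF det _ \<rho>, where f = ?f])
        fix c and v :: "nat \<Rightarrow> real" assume v: "\<And>i. i < n \<Longrightarrow> \<bar>v i - lvec n B c i\<bar> \<le> \<rho>"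
        show "?f (lvec n B c) \<le> slab_majorant n T \<rho> A v"
        proof (cases "A < \<bar>lvec n B c 0\<bar>")
          case True
          then have "ennreal (tent_avg n T (lvec n B c)) \<le> slab_majorant n T \<rho> A v"
            using T n \<open>\<rho> > 0\<close> A v by (intro tent_avg_le_majorant) auto
          then show ?thesis using True by simp
        qed simp
      qed (use n in auto)
      also have "\<dots> \<le> ennreal (K' T)"
        unfolding K'_def using T n \<open>\<rho> > 0\<close> A by (intro nn_integral_slab_majorant_le) auto
      also have "(\<integral>\<^sup>+c. ennreal (tent_avg n T (lvec n B c)) * indicator D c \<partial>count_space (Zn n))
          = (\<Sum>c\<in>D. ennreal (tent_avg n T (lvec n B c)) * indicator D c)"
        using fin by (intro nn_integral_count_space') (auto simp: D_def)
      also have "\<dots> = ennreal (E T)" by (simp add: E_def sum_ennreal)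
      finally show ?thesis
        using K'_nonneg by (simp add: E_def sum_nonneg)
    qed
    have n0: "n - 1 > 0" using n by simp
    have inv: "(\<lambda>T. 1 / real T) \<longlonglongrightarrow> 0" by (rule lim_1_over_n)
    have "(\<lambda>T. (1 / real T) ^ (n - 1)) \<longlonglongrightarrow> 0 ^ (n - 1)" by (intro tendsto_power inv)
    then have inv': "(\<lambda>T. (1 / real T) ^ (n - 1)) \<longlonglongrightarrow> 0" using n0 by (simp add: zero_power)
    have "(\<lambda>T. ((2 + 2 * (1 / real T))\<^sup>2 * (1 + \<rho> / A) * (1 + (4 + 4 * \<rho>) / (A - \<rho>))) ^ (n - 1)
        * (2 + \<rho> * (1 / real T) ^ (n - 1))\<^sup>2)
      \<longlonglongrightarrow> ((2 + 2 * 0)\<^sup>2 * (1 + \<rho> / A) * (1 + (4 + 4 * \<rho>) / (A - \<rho>))) ^ (n - 1) * (2 + \<rho> * 0)\<^sup>2"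
      by (intro tendsto_intros inv inv')
    then have "K' \<longlonglongrightarrow> K A" by (simp add: K'_def K_def power_one_over field_simps)
    moreover have "E \<longlonglongrightarrow> (\<Sum>c\<in>D. 0)"
      unfolding E_def using n by (intro tendsto_sum tent_avg_tendsto_0) (auto simp: D_def lvec_def)
    ultimately have "(\<lambda>T. K' T + E T) \<longlonglongrightarrow> K A" using tendsto_add by fastforce
    then have "(\<lambda>T. ennreal (K' T + E T)) \<longlonglongrightarrow> ennreal (K A)" by (rule tendsto_ennrealI)
    then have "limsup (\<lambda>T. ennreal (K' T + E T)) = ennreal (K A)"
      by (intro lim_imp_Limsup) auto
    moreover have "limsup ?S \<le> limsup (\<lambda>T. ennreal (K' T + E T))"
      using le by (intro Limsup_mono eventually_mono[OF eventually_gt_at_top[of 0]])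
    ultimately show ?thesis by simp
  qed
  \<comment> \<open>Along \<open>A = \<rho> + m\<close> both correction factors tend to 1.\<close>
  have "(\<lambda>m. K (\<rho> + real m)) \<longlonglongrightarrow> (4 * (1 + 0) * (1 + 0)) ^ (n - 1) * 4"
    unfolding K_def by (intro tendsto_intros) real_asymp+
  moreover have "(4 * (1 + 0) * (1 + 0)) ^ (n - 1) * 4 = (4 :: real) ^ n" using n by (cases n) auto
  ultimately have "(\<lambda>m. ennreal (K (\<rho> + real m))) \<longlonglongrightarrow> ennreal (4 ^ n)"
    by (intro tendsto_ennrealI) simp
  moreover have "eventually (\<lambda>m. limsup ?S \<le> ennreal (K (\<rho> + real m))) sequentially"
    using eventually_gt_at_top[of 0] by eventually_elim (auto intro: bound)
  ultimately have "limsup ?S \<le> ennreal (4 ^ n)"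
    by (rule tendsto_lowerbound) simp
  then show ?thesis by (simp add: ennreal_power[symmetric])
qed

text \<open>On a probability space the truncation level is an integrable dominating function, so the
  reverse Fatou lemma applies to the horosphere averages. Monotone convergence in the level then
  removes the truncation.\<close>

lemma siegel_mean_value_le:
  assumes \<nu>: "siegel_measure n \<nu>" and n: "n \<ge> 2"
  shows "(\<integral>\<^sup>+L. lattice_sum (tent n) L \<partial>\<nu>) \<le> 4 ^ n"
proof -
  let ?F = "lattice_sum (tent n)" and ?A = "\<lambda>T. lattice_sum (\<lambda>w. ennreal (tent_avg n T w))"
  interpret prob_space \<nu> using \<nu> by (simp add: siegel_measure_def)
  have F [measurable]: "?F \<in> borel_measurable \<nu>"
    by (rule measurable_lattice_sum[OF \<nu> measurable_tent_lvec])
  \<comment> \<open>The index is shifted because the horosphere matrices need \<open>T > 0\<close>;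
    the limit superior is unaffected.\<close>
  have A [measurable]: "?A (Suc T) \<in> borel_measurable \<nu>" for T
    using siegel_horosphere_average(1)[OF \<nu>, of "Suc T"] n by simp
  have trunc: "(\<integral>\<^sup>+L. min (?F L) (of_nat C) \<partial>\<nu>) \<le> 4 ^ n" for C :: nat
  proof -
    have "(\<integral>\<^sup>+L. min (?F L) (of_nat C) \<partial>\<nu>) \<le> limsup (\<lambda>T. \<integral>\<^sup>+L. min (?A (Suc T) L) (of_nat C) \<partial>\<nu>)"
      using siegel_horosphere_average(2)[OF \<nu>] n
      by (intro le_Limsup) (auto intro!: always_eventually)
    also have "\<dots> \<le> (\<integral>\<^sup>+L. limsup (\<lambda>T. min (?A (Suc T) L) (of_nat C)) \<partial>\<nu>)"
      by (rule nn_integral_limsup[where w = "\<lambda>_. of_nat C"])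
         (auto simp: emeasure_space_1 ennreal_of_nat_eq_real_of_nat)
    also have "\<dots> \<le> (\<integral>\<^sup>+L. 4 ^ n \<partial>\<nu>)"
    proof (rule nn_integral_mono)
      fix L assume "L \<in> space \<nu>"
      then obtain B where B: "B \<in> SLn n" "L = lat n B"
        using \<nu> by (auto simp: siegel_measure_def unimod_lattices_def)
      have "limsup (\<lambda>T. min (?A (Suc T) L) (of_nat C)) \<le> limsup (\<lambda>T. ?A (Suc T) L)"
        by (intro Limsup_mono) (auto intro!: always_eventually)
      also have "\<dots> = limsup (\<lambda>T. ?A T L)"
        using limsup_shift[of "\<lambda>T. ?A T L"] by simp
      also have "\<dots> \<le> 4 ^ n" unfolding B(2) by (rule limsup_lattice_sum_tent_avg[OF B(1) n])
      finally show "limsup (\<lambda>T. min (?A (Suc T) L) (of_nat C)) \<le> 4 ^ n" .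
    qed
    also have "\<dots> = 4 ^ n" by (simp add: emeasure_space_1)
    finally show ?thesis .
  qed
  have "?F L = (SUP C::nat. min (?F L) (of_nat C))" for L
  proof -
    have "(SUP C::nat. min (?F L) (of_nat C)) = inf (?F L) (SUP C::nat. of_nat C)"
      by (simp add: inf_SUP flip: inf_min)
    then show ?thesis by (simp add: ennreal_SUP_of_nat_eq_top)
  qed
  then have "(\<integral>\<^sup>+L. ?F L \<partial>\<nu>) = (\<integral>\<^sup>+L. (SUP C::nat. min (?F L) (of_nat C)) \<partial>\<nu>)" by simp
  also have "\<dots> = (SUP C::nat. \<integral>\<^sup>+L. min (?F L) (of_nat C) \<partial>\<nu>)"
    by (rule nn_integral_monotone_convergence_SUP)
       (auto simp: incseq_def le_fun_def intro!: min.coboundedI2 order.trans[OF min.cobounded2] of_nat_mono)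
  also have "\<dots> \<le> 4 ^ n" by (intro SUP_least trunc)
  finally show ?thesis .
qed

section \<open>Conclusion by Markov's inequality\<close>

theorem mainTheorem5:
  shows "\<exists>d::real > 0. \<exists>\<kappa>::real > 0. \<exists>N::nat. \<forall>n \<ge> N. \<forall>\<nu>. siegel_measure n \<nu> \<longrightarrow>
     measure \<nu> {L \<in> unimod_lattices n. covering_radius n L < d * sqrt (real n)}
       \<ge> 1 - 2 powr (- \<kappa> * real n)"
proof -
  have "measure \<nu> {L \<in> unimod_lattices n. covering_radius n L < 3 * sqrt (real n)} \<ge> 1 - 2 powr (- 1 * real n)"
    if n: "n \<ge> 2" and \<nu>: "siegel_measure n \<nu>" for n :: nat and \<nu>
  proof -
    interpret prob_space \<nu> using \<nu> by (simp add: siegel_measure_def)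
    have sp: "space \<nu> = unimod_lattices n" using \<nu> by (simp add: siegel_measure_def)
    let ?F = "lattice_sum (tent n)"
    define G where "G = {L \<in> unimod_lattices n. covering_radius n L < 3 * sqrt (real n)}"
    have G [measurable]: "G \<in> sets \<nu>" unfolding G_def by (rule covering_radius_event[OF \<nu>])
    have F [measurable]: "?F \<in> borel_measurable \<nu>"
      by (rule measurable_lattice_sum[OF \<nu> measurable_tent_lvec])
    \<comment> \<open>Both lower bounds in one pointwise inequality. Integrating it is Markov's
      inequality without subtraction in \<open>ennreal\<close>; the common \<open>4 ^ n\<close>
      cancels later among reals.\<close>
    have "4 ^ n + 4 ^ n * indicator (space \<nu> - G) L \<le> 2 ^ n + ?F L" if L: "L \<in> space \<nu>" for L
    proof -
      obtain B where B: "B \<in> SLn n" "L = lat n B" using L by (auto simp: sp unimod_lattices_def)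
      show ?thesis
      proof (cases "L \<in> G")
        case True
        then show ?thesis using lattice_sum_tent_ge[OF B(1)] B(2) by simp
      next
        case False
        then have "\<not> covering_radius n (lat n B) < 3 * sqrt (real n)"
          using L B(2) by (simp add: G_def sp)
        then have "2 * 4 ^ n \<le> 2 ^ n + ?F L"
          using lattice_sum_tent_ge_covering[OF B(1)] n B(2) by simp
        then show ?thesis using False L by (simp add: mult_2)
      qed
    qed
    then have "(\<integral>\<^sup>+L. 4 ^ n + 4 ^ n * indicator (space \<nu> - G) L \<partial>\<nu>) \<le> (\<integral>\<^sup>+L. 2 ^ n + ?F L \<partial>\<nu>)"
      by (intro nn_integral_mono) auto
    also have "\<dots> = 2 ^ n + (\<integral>\<^sup>+L. ?F L \<partial>\<nu>)"
      by (subst nn_integral_add) (auto simp: emeasure_space_1)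
    also have "\<dots> \<le> 2 ^ n + 4 ^ n"
      by (intro add_left_mono siegel_mean_value_le[OF \<nu> n])
    also have "(\<integral>\<^sup>+L. 4 ^ n + 4 ^ n * indicator (space \<nu> - G) L \<partial>\<nu>) = 4 ^ n + 4 ^ n * emeasure \<nu> (space \<nu> - G)"
      by (subst nn_integral_add) (auto simp: emeasure_space_1 nn_integral_cmult_indicator)
    also have "\<dots> = ennreal (4 ^ n + 4 ^ n * prob (space \<nu> - G))"
      by (simp add: emeasure_eq_measure ennreal_mult' flip: ennreal_power)
    also have "2 ^ n + 4 ^ n = ennreal (2 ^ n + 4 ^ n)"
      by (simp flip: ennreal_power)
    finally have "4 ^ n * prob (space \<nu> - G) \<le> 2 ^ n" by simp
    moreover have "(4 :: real) ^ n = 2 ^ n * 2 ^ n" by (simp flip: power_mult_distrib)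
    ultimately have "prob (space \<nu> - G) \<le> 1 / 2 ^ n" by (simp add: field_simps)
    then have "prob G \<ge> 1 - 1 / 2 ^ n" by (simp add: prob_compl)
    moreover have "2 powr (- 1 * real n) = 1 / 2 ^ n" by (simp add: powr_minus powr_realpow divide_simps)
    ultimately show ?thesis by (simp add: G_def)
  qed
  \<comment> \<open>The threshold 2 is inherited from the mean value inequality, whose averaging
    needs at least one expanding direction.\<close>
  then show ?thesis
    by (intro exI[of _ 3] exI[of _ 1] exI[of _ 2] conjI) auto
qed

end
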